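(* Every median metric space is diagonal.
   Context: Metric spaces have a finite, symmetric, non-degenerate distance satisfying the triangle inequality. A point $z$ is between $x$ and $y$ if $d(x,y)=d(x,z)+d(z,y)$, strictly between if moreover $z\neq x,y$; $[x,y]$ (resp. $]x,y[$) is the set of points between (resp. strictly between) $x$ and $y$. A metric space is median if for all points $x,y,z$ the intersection $[x,y]\cap[y,z]\cap[x,z]$ consists of a single point. A $k$-path ($k\ge0$) in $X$ is a sequence $\langle x_0,\dots,x_k\rangle$ of points of $X$ with $x_i\ne x_{i+1}$ for $0\le i<k$; it is saturated if each $]x_i,x_{i+1}[$ is empty. Magnitude complex: $\mathrm{MC}_k(X)$ is the free abelian group on the $k$-paths of $X$, with boundary $\partial_k=\sum_{i=1}^{k-1}(-1)^i\partial_{k,i}$, where $\partial_{k,i}\langle x_0,\dots,x_k\rangle=\langle x_0,\dots,\widehat{x_i},\dots,x_k\rangle$ if $x_i$ is between $x_{i-1}$ and $x_{i+1}$, and $0$ otherwise. $\mathrm{MH}_*(X)$ is its homology. $X$ is diagonal if for every $k$, $\mathrm{MH}_k(X)$ is generated by classes of cycles that are integral linear combinations of saturated $k$-paths of $X$. *)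

theory Defs
  imports "HOL-Analysis.Abstract_Metric_Spaces" "HOL-Algebra.Free_Abelian_Groups"
begin

context Metric_space
begin

definition interval :: "'a \<Rightarrow> 'a \<Rightarrow> 'a set" where
  "interval x y = {z \<in> M. d x y = d x z + d z y}"

definition open_interval :: "'a \<Rightarrow> 'a \<Rightarrow> 'a set" where
  "open_interval x y = interval x y - {x, y}"

definition median_space :: bool where
  "median_space \<longleftrightarrow>
     (\<forall>x\<in>M. \<forall>y\<in>M. \<forall>z\<in>M. \<exists>m. interval x y \<inter> interval y z \<inter> interval x z = {m})"

text \<open>The $k$-path $\langle x_0,\dots,x_k\rangle$ is encoded as the list of its $k+1$ points.\<close>

definition paths :: "nat \<Rightarrow> 'a list set" where
  "paths k = {p. length p = Suc k \<and> set p \<subseteq> M \<and> (\<forall>i<k. p ! i \<noteq> p ! Suc i)}"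

definition saturated_paths :: "nat \<Rightarrow> 'a list set" where
  "saturated_paths k = {p \<in> paths k. \<forall>i<k. open_interval (p ! i) (p ! Suc i) = {}}"

definition magnitude_chains :: "nat \<Rightarrow> ('a list \<Rightarrow>\<^sub>0 int) monoid" where
  "magnitude_chains k = free_Abelian_group (paths k)"

text \<open>
  The linear extension of $\partial_{k,i}$; it is meaningful for $0 < i < k$ only, and the degree
  $k$ can be left implicit because it is determined by the length of the path.
\<close>

definition face :: "nat \<Rightarrow> ('a list \<Rightarrow>\<^sub>0 int) \<Rightarrow> ('a list \<Rightarrow>\<^sub>0 int)" where
  "face i = frag_extend (\<lambda>p. if p ! i \<in> interval (p ! (i - 1)) (p ! Suc i)
                              then frag_of (take i p @ drop (Suc i) p) else 0)"

text \<open>The sum is empty for $k \le 1$, so the boundary vanishes in degrees $0$ and $1$.\<close>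

definition magnitude_boundary :: "nat \<Rightarrow> ('a list \<Rightarrow>\<^sub>0 int) \<Rightarrow> ('a list \<Rightarrow>\<^sub>0 int)" where
  "magnitude_boundary k c = (\<Sum>i = 1..<k. frag_cmul ((-1) ^ i) (face i c))"

definition magnitude_cycles :: "nat \<Rightarrow> ('a list \<Rightarrow>\<^sub>0 int) set" where
  "magnitude_cycles k = {c \<in> carrier (magnitude_chains k). magnitude_boundary k c = 0}"

definition magnitude_boundaries :: "nat \<Rightarrow> ('a list \<Rightarrow>\<^sub>0 int) set" where
  "magnitude_boundaries k = magnitude_boundary (Suc k) ` carrier (magnitude_chains (Suc k))"

definition magnitude_cycle_group :: "nat \<Rightarrow> ('a list \<Rightarrow>\<^sub>0 int) monoid" where
  "magnitude_cycle_group k = subgroup_generated (magnitude_chains k) (magnitude_cycles k)"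

definition magnitude_homology :: "nat \<Rightarrow> ('a list \<Rightarrow>\<^sub>0 int) set monoid" where
  "magnitude_homology k = magnitude_cycle_group k Mod magnitude_boundaries k"

definition homology_class :: "nat \<Rightarrow> ('a list \<Rightarrow>\<^sub>0 int) \<Rightarrow> ('a list \<Rightarrow>\<^sub>0 int) set" where
  "homology_class k z = magnitude_boundaries k #>\<^bsub>magnitude_cycle_group k\<^esub> z"

definition diagonal :: bool where
  "diagonal \<longleftrightarrow>
     (\<forall>k. carrier (magnitude_homology k) =
            generate (magnitude_homology k)
              {homology_class k z | z.
                 z \<in> magnitude_cycles k \<and> Poly_Mapping.keys z \<subseteq> saturated_paths k})"

end

end

theory Submission
  imports Defs
begin

text \<open>
  Every chain is a combination of paths, and both the boundary operator and the notion of
  saturation only depend on betweenness. The proof reduces a cycle one edge at a time, starting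
  from its first vertex. All faces of a path keep its first vertex \<open>y\<close>, so a cycle splits into
  cycles with a fixed first vertex, which are recorded by the tails that follow \<open>y\<close>.

  \<^bold>\<open>The discrete case.\<close> Call two points of a set \<open>S\<close> an edge if no third point of \<open>S\<close> lies
  between them, and suppose that \<open>S\<close> is modular: any three points of \<open>S\<close> have a median in
  \<open>S\<close>. Let \<open>L\<close> be a cycle of tails after \<open>y\<close> each of whose first points is reached from \<open>y\<close>
  through one of finitely many edges \<open>(y, b)\<close>, \<open>b \<in> B\<close>. Inserting one such \<open>b\<close> between \<open>y\<close>
  and the first point, wherever possible, is a chain homotopy which replaces \<open>L\<close> by tails that
  either start at \<open>b\<close> or avoid \<open>b\<close> (\<open>peel_edge\<close>). What follows \<open>b\<close> is again a cycle, shorter by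
  one. It leaves \<open>b\<close> either backwards through \<open>y\<close> or, because the point reached lies beyond
  \<open>b\<close> and also beyond some \<open>b' \<in> B\<close>, through the fourth corner of the square spanned by \<open>y\<close>,
  \<open>b\<close> and \<open>b'\<close>; this corner is a median, and it forms an edge with \<open>b\<close> (\<open>edge_join\<close>). So the
  induction on the length applies to the part after \<open>b\<close>, and every correction term lies in
  the region reached through \<open>B - {b}\<close>, where an induction on \<open>B\<close> applies. The correction terms
  need not form a cycle on their own, but their unsaturated part does: a face of a saturated path
  is never a face of an unsaturated one (\<open>saturated_of_common_face\<close>). This proves
  \<open>cycle_homologous_to_saturated\<close>.

  \<^bold>\<open>The general case.\<close> In a median space there may be no edges at all. However, a cycle involves
  only a finite set of points, and the argument above asks for edges of \<open>S\<close> only at the first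
  vertex \<open>y\<close>. Given a finite set \<open>F\<close>, one finds finitely many points \<open>b\<close> so close to \<open>y\<close> that each
  point of \<open>F\<close> lies either beyond \<open>b\<close>, seen from \<open>y\<close>, or beyond \<open>y\<close>, seen from \<open>b\<close>; they
  can be chosen such that each point of \<open>F\<close> other than \<open>y\<close> lies beyond one of them. The set
  \<open>S\<close> of all points with this property is modular, because medians are unique in a median space
  and this makes both kinds of region convex, and every \<open>(y, b)\<close> is an edge of \<open>S\<close>
  (\<open>finite_in_modular_with_edges\<close>).

  Finally, saturation in \<open>S\<close> is weaker than saturation in the whole space. The saturated
  representative of a cycle is, however, forced to be the saturated part of that cycle, because
  boundaries contain no saturated path. So it suffices to put into \<open>F\<close> one witness against each
  pair of consecutive vertices that is unsaturated in the whole space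
  (\<open>cycle_homologous_to_saturated_part\<close>, \<open>finite_with_separating_points\<close>).
\<close>

section \<open>Chains of lists\<close>

definition prepend :: "'a \<Rightarrow> ('a list \<Rightarrow>\<^sub>0 int) \<Rightarrow> ('a list \<Rightarrow>\<^sub>0 int)" where
  "prepend x = frag_extend (\<lambda>p. frag_of (x # p))"

definition tails :: "'a \<Rightarrow> ('a list \<Rightarrow>\<^sub>0 int) \<Rightarrow> ('a list \<Rightarrow>\<^sub>0 int)" where
  "tails x = frag_extend (\<lambda>p. if p \<noteq> [] \<and> hd p = x then frag_of (tl p) else 0)"

definition part :: "('b \<Rightarrow> bool) \<Rightarrow> ('b \<Rightarrow>\<^sub>0 int) \<Rightarrow> ('b \<Rightarrow>\<^sub>0 int)" where
  "part P = frag_extend (\<lambda>p. if P p then frag_of p else 0)"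

text \<open>
  Identities between linear operators reduce to single basis elements in this way.
\<close>

lemma linear_eqI:
  assumes "\<And>a b. f (a - b) = f a - f b" "\<And>a b. g (a - b) = g a - g b"
    and "\<And>p. p \<in> Poly_Mapping.keys c \<Longrightarrow> f (frag_of p) = g (frag_of p)"
  shows "f c = (g c :: 'c :: ab_group_add)"
proof -
  have "f (0 - 0) = f 0 - f 0" "g (0 - 0) = g 0 - g 0" using assms(1,2) by blast+
  then have zero: "f 0 = 0" "g 0 = 0" by simp_all
  have "Poly_Mapping.keys c \<subseteq> Poly_Mapping.keys c" by simp
  then show ?thesis
    by (induction c rule: frag_induction) (use assms zero in auto)
qed

lemma lookup_part: "poly_mapping.lookup (part P c) p = (if P p then poly_mapping.lookup c p else 0)"
  by (rule linear_eqI[where c = c])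
    (auto simp: part_def frag_extend_diff lookup_minus)

lemma keys_part: "Poly_Mapping.keys (part P c) = {p \<in> Poly_Mapping.keys c. P p}"
  by (auto simp: in_keys_iff lookup_part split: if_splits)

lemma part_add_part_not: "part P c + part (\<lambda>p. \<not> P p) c = c"
  by (rule poly_mapping_eqI) (auto simp: lookup_add lookup_part)

lemma part_id: "(\<And>p. p \<in> Poly_Mapping.keys c \<Longrightarrow> P p) \<Longrightarrow> part P c = c"
  by (rule poly_mapping_eqI) (auto simp: lookup_part in_keys_iff)

lemma part_zero: "(\<And>p. p \<in> Poly_Mapping.keys c \<Longrightarrow> \<not> P p) \<Longrightarrow> part P c = 0"
  by (rule poly_mapping_eqI) (auto simp: lookup_part in_keys_iff)

lemma part_diff: "part P (a - b) = part P a - part P b"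
  by (simp add: part_def frag_extend_diff)

lemma prepend_diff: "prepend x (a - b) = prepend x a - prepend x b"
  by (simp add: prepend_def frag_extend_diff)

lemma prepend_add: "prepend x (a + b) = prepend x a + prepend x b"
  by (simp add: prepend_def frag_extend_add)

lemma prepend_0 [simp]: "prepend x 0 = 0"
  by (simp add: prepend_def)

lemma prepend_of [simp]: "prepend x (frag_of p) = frag_of (x # p)"
  by (simp add: prepend_def)

lemma lookup_prepend_Cons:
  "poly_mapping.lookup (prepend x c) (y # p) = (if y = x then poly_mapping.lookup c p else 0)"
  by (rule linear_eqI[where c = c]) (auto simp: prepend_diff lookup_minus)

lemma lookup_prepend_Nil: "poly_mapping.lookup (prepend x c) [] = 0"
  by (rule linear_eqI[where c = c]) (auto simp: prepend_diff lookup_minus)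

lemma keys_prepend: "Poly_Mapping.keys (prepend x c) = (#) x ` Poly_Mapping.keys c"
proof (rule Set.set_eqI)
  fix q show "q \<in> Poly_Mapping.keys (prepend x c) \<longleftrightarrow> q \<in> (#) x ` Poly_Mapping.keys c"
    by (cases q) (auto simp: in_keys_iff lookup_prepend_Cons lookup_prepend_Nil)
qed

lemma tails_prepend [simp]: "tails x (prepend x c) = c"
  by (rule linear_eqI[where c = c]) (auto simp: tails_def prepend_def frag_extend_diff)

lemma lookup_tails: "poly_mapping.lookup (tails x c) p = poly_mapping.lookup c (x # p)"
proof (rule linear_eqI[where c = c])
  fix q show "poly_mapping.lookup (tails x (frag_of q)) p = poly_mapping.lookup (frag_of q) (x # p)"
    by (cases q) (auto simp: tails_def)
qed (auto simp: tails_def frag_extend_diff lookup_minus)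

lemma keys_tails: "Poly_Mapping.keys (tails x c) = {p. x # p \<in> Poly_Mapping.keys c}"
  by (auto simp: in_keys_iff lookup_tails)

lemma prepend_tails: "prepend x (tails x c) = part (\<lambda>p. p \<noteq> [] \<and> hd p = x) c"
proof (rule poly_mapping_eqI)
  fix p show "poly_mapping.lookup (prepend x (tails x c)) p
      = poly_mapping.lookup (part (\<lambda>p. p \<noteq> [] \<and> hd p = x) c) p"
    by (cases p) (auto simp: lookup_prepend_Cons lookup_prepend_Nil lookup_tails lookup_part)
qed

section \<open>Betweenness and edges\<close>

text \<open>
  The properties of metric betweenness that are needed. The last one is the four point property:
  both sides say that \<open>x\<close>, \<open>y\<close>, \<open>z\<close>, \<open>w\<close> lie on a geodesic in this order.
\<close>

locale betweenness =
  fixes M :: "'a set" and bet :: "'a \<Rightarrow> 'a \<Rightarrow> 'a \<Rightarrow> bool"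
  assumes bet_carrier: "bet x y z \<Longrightarrow> x \<in> M \<and> y \<in> M \<and> z \<in> M"
    and bet_refl: "x \<in> M \<Longrightarrow> y \<in> M \<Longrightarrow> bet x x y"
    and bet_sym: "bet x y z \<Longrightarrow> bet z y x"
    and bet_same: "bet x y x \<Longrightarrow> y = x"
    and bet_trans: "bet x y z \<and> bet x z w \<longleftrightarrow> bet y z w \<and> bet x y w"
begin

lemma bet_trans_left:
  assumes "bet x y z" "bet x z w" shows "bet y z w" "bet x y w"
  using assms bet_trans[of x y z w] by simp_all

lemma bet_trans_right:
  assumes "bet y z w" "bet x y w" shows "bet x y z" "bet x z w"
  using assms bet_trans[of x y z w] by simp_all

lemma bet_antisym: "bet x y z \<Longrightarrow> bet x z y \<Longrightarrow> y = z"
  using bet_trans_left(1) bet_same by metis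

text \<open>
  Relative to a subset \<open>S\<close>, since the proof works with subsets that have more edges than the whole
  space; \<open>edge M\<close> is saturation in the original sense.
\<close>

definition edge :: "'a set \<Rightarrow> 'a \<Rightarrow> 'a \<Rightarrow> bool" where
  "edge S x y \<longleftrightarrow> x \<in> S \<and> y \<in> S \<and> x \<noteq> y \<and> (\<forall>u\<in>S. bet x u y \<longrightarrow> u = x \<or> u = y)"

text \<open>
  For the vertex set of a graph, this says that the graph is modular.
\<close>

definition modular :: "'a set \<Rightarrow> bool" where
  "modular S \<longleftrightarrow> S \<subseteq> M \<and>
     (\<forall>x\<in>S. \<forall>y\<in>S. \<forall>z\<in>S. \<exists>m\<in>S. bet x m y \<and> bet y m z \<and> bet x m z)"

definition walk :: "'a set \<Rightarrow> 'a list \<Rightarrow> bool" where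
  "walk S p \<longleftrightarrow> set p \<subseteq> S \<and> successively (\<noteq>) p"

text \<open>
  The points that are reached from \<open>y\<close> on a geodesic through \<open>B\<close>: a union of halfspaces if the
  points of \<open>B\<close> form edges with \<open>y\<close>.
\<close>

definition beyond :: "'a \<Rightarrow> 'a set \<Rightarrow> 'a set" where
  "beyond y B = {x. \<exists>b\<in>B. bet y b x}"

lemma edge_sym: "edge S x y \<Longrightarrow> edge S y x"
  unfolding edge_def using bet_sym by metis

lemma modularE:
  assumes "modular S" "x \<in> S" "y \<in> S" "z \<in> S"
  obtains m where "m \<in> S" "bet x m y" "bet y m z" "bet x m z"
  using assms unfolding modular_def by blast

text \<open>
  An edge cuts \<open>S\<close> into two halfspaces: the median of \<open>y\<close>, \<open>b\<close> and \<open>x\<close> lies between \<open>y\<close> and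
  \<open>b\<close>, so it is one of them.
\<close>

lemma edge_dichotomy:
  assumes "modular S" "edge S y b" "x \<in> S"
  shows "bet y b x \<or> bet b y x"
proof -
  obtain m where "m \<in> S" "bet y m b" "bet b m x" "bet y m x"
    using modularE[of S y b x] assms by (auto simp: edge_def)
  then show ?thesis using assms(2) unfolding edge_def by metis
qed

text \<open>
  If two edges form a geodesic from \<open>x\<close> to \<open>z\<close>, any other geodesic from \<open>x\<close> to \<open>z\<close> through a
  single intermediate vertex consists of edges as well. Indeed, a point other than \<open>y\<close> strictly
  between \<open>x\<close> and \<open>z\<close> is opposite to \<open>y\<close>, in that both \<open>x\<close> and \<open>z\<close> lie between the two, and
  two distinct opposite points cannot lie on a common geodesic from \<open>x\<close> to \<open>z\<close>.
\<close>

lemma edge_square_diagonal: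
  assumes "modular S" and xy: "edge S x y" and yz: "edge S y z" and "bet x y z"
    and "v \<in> S" "bet x v z" "v \<noteq> x" "v \<noteq> z"
  shows "edge S x v"
proof (cases "v = y")
  case True then show ?thesis using xy by simp
next
  case False
  have S: "x \<in> S" "y \<in> S" "z \<in> S" using xy yz by (auto simp: edge_def)
  have opp: "bet y z u" if u: "u \<in> S" "bet x u z" "u \<noteq> y" "u \<noteq> x" "u \<noteq> z" for u
  proof -
    have "\<not> bet z y u"
    proof
      assume "bet z y u"
      then have "bet y u x" using bet_trans_left(1) bet_sym[OF u(2)] by blast
      then show False using xy u bet_sym unfolding edge_def by metis
    qed
    then show ?thesis
      using edge_dichotomy[OF assms(1) yz u(1)] by blast
  qed
  have opp': "bet y x u" if u: "u \<in> S" "bet x u z" "u \<noteq> y" "u \<noteq> x" "u \<noteq> z" for u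
  proof -
    have "\<not> bet x y u"
    proof
      assume "bet x y u"
      then have "bet y u z" using bet_trans_left(1) u(2) by blast
      then show False using yz u unfolding edge_def by metis
    qed
    then show ?thesis
      using edge_dichotomy[OF assms(1) xy u(1)] by blast
  qed
  have "u = x \<or> u = v" if u: "u \<in> S" "bet x u v" for u
  proof (rule ccontr)
    assume "\<not> (u = x \<or> u = v)"
    then have ne: "u \<noteq> x" "u \<noteq> v" by auto
    have xuz: "bet x u z" and uvz: "bet u v z"
      using bet_trans_left[OF u(2) \<open>bet x v z\<close>] by auto
    have "u \<noteq> z" using uvz bet_same assms(8) by blast
    have "bet y x v" using opp' False assms by blast
    then have "u \<noteq> y" using u(2) bet_antisym bet_sym ne xy bet_same bet_trans_left(1) by metis
    have "bet y z u" using opp u \<open>u \<noteq> y\<close> ne \<open>u \<noteq> z\<close> xuz by blast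
    moreover have "bet y u v" using bet_trans_right(2)[OF u(2) \<open>bet y x v\<close>] .
    ultimately have "bet z u v" using bet_trans_left(1) by blast
    then show False using uvz bet_antisym bet_sym ne by metis
  qed
  then show ?thesis using assms(5,7) S(1) unfolding edge_def by metis
qed

text \<open>
  Two edges \<open>(y, b)\<close> and \<open>(y, b')\<close> that both point towards \<open>x\<close> span a square, whose fourth corner
  is the median of \<open>b\<close>, \<open>b'\<close> and \<open>x\<close>. The side from \<open>b\<close> to this corner is parallel to
  \<open>(y, b')\<close>, which is why it is an edge: a point on it equals the corner if it is on the side of
  \<open>b'\<close>, and equals \<open>b\<close> if it is on the side of \<open>y\<close>.
\<close>

lemma edge_join:
  assumes "modular S" and b: "edge S y b" and b': "edge S y b'" and "b \<noteq> b'"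
    and x: "x \<in> S" "bet y b x" "bet y b' x"
  obtains c where "edge S b c" "bet y b c" "bet y b' c" "bet b c x"
proof -
  have S: "y \<in> S" "b \<in> S" "b' \<in> S" using b b' by (auto simp: edge_def)
  obtain c where c: "c \<in> S" "bet b c b'" "bet b' c x" "bet b c x"
    using modularE[OF assms(1) S(2,3) x(1)] by blast
  have ybc: "bet y b c" and yb'c: "bet y b' c"
    using bet_trans_right(1)[OF c(4) x(2)] bet_trans_right(1)[OF c(3) x(3)] .
  have ne: "\<not> bet y b' b" using b b' assms(4) unfolding edge_def by metis
  have "u = b \<or> u = c" if u: "u \<in> S" "bet b u c" for u
  proof -
    have bub': "bet b u b'" and ucb': "bet u c b'" using bet_trans_left[OF u(2) c(2)] by auto
    have ybu: "bet y b u" and yuc: "bet y u c" using bet_trans_right[OF u(2) ybc] .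
    show ?thesis
      using edge_dichotomy[OF assms(1) b' u(1)]
    proof
      assume "bet y b' u"
      with yuc have "bet b' u c" using bet_trans_left(1) by blast
      then show ?thesis using ucb' bet_antisym bet_sym by metis
    next
      assume "bet b' y u"
      then have "bet u b b'" using bet_trans_left(2)[OF bet_sym[OF ybu] bet_sym] by blast
      then show ?thesis using bub' bet_antisym bet_sym by metis
    qed
  qed
  then have "edge S b c" using S c ne yb'c unfolding edge_def by metis
  then show ?thesis using that ybc yb'c c(4) by blast
qed

section \<open>The boundary operator on tails\<close>

text \<open>
  Up to the sign and the common first vertex \<open>y\<close>, the boundary of the path \<open>y # p\<close>: either the
  first point of \<open>p\<close> is deleted, or one of the later points is.
\<close>

fun tail_boundary_path :: "'a \<Rightarrow> 'a list \<Rightarrow> ('a list \<Rightarrow>\<^sub>0 int)" where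
  "tail_boundary_path y [] = 0"
| "tail_boundary_path y (x # r) = (if r \<noteq> [] \<and> bet y x (hd r) then frag_of r else 0) - prepend x (tail_boundary_path x r)"

definition tail_boundary :: "'a \<Rightarrow> ('a list \<Rightarrow>\<^sub>0 int) \<Rightarrow> ('a list \<Rightarrow>\<^sub>0 int)" where
  "tail_boundary y = frag_extend (tail_boundary_path y)"

lemma tail_boundary_diff: "tail_boundary y (a - b) = tail_boundary y a - tail_boundary y b"
  by (simp add: tail_boundary_def frag_extend_diff)

lemma tail_boundary_add: "tail_boundary y (a + b) = tail_boundary y a + tail_boundary y b"
  by (simp add: tail_boundary_def frag_extend_add)

lemma tail_boundary_0 [simp]: "tail_boundary y 0 = 0"
  by (simp add: tail_boundary_def)

lemma tail_boundary_of [simp]: "tail_boundary y (frag_of p) = tail_boundary_path y p"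
  by (simp add: tail_boundary_def)

lemma tail_boundary_prepend:
  "tail_boundary y (prepend x c) = part (\<lambda>r. r \<noteq> [] \<and> bet y x (hd r)) c - prepend x (tail_boundary x c)"
  by (rule linear_eqI[where c = c])
    (auto simp: prepend_diff tail_boundary_diff part_diff, auto simp: part_def)

text \<open>
  This is what makes the boundary square to zero: deleting \<open>x\<close> from the faces of \<open>x # r\<close> gives
  the faces of the path without \<open>x\<close>. Only the face that deletes the first point of \<open>r\<close> needs an
  argument; for it, the conditions for the two orders of deletion agree by the four point property.
\<close>

lemma part_tail_boundary_path:
  assumes "r \<noteq> []"
  shows "part (\<lambda>q. q \<noteq> [] \<and> bet y x (hd q)) (tail_boundary_path x r) = (if bet y x (hd r) then tail_boundary_path y r else 0)"
proof -
  obtain z t where r: "r = z # t" using assms by (cases r) auto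
  have *: "part (\<lambda>q. q \<noteq> [] \<and> bet y x (hd q)) (prepend z c) = (if bet y x z then prepend z c else 0)" for c
    by (cases "bet y x z") (auto simp: keys_prepend intro!: part_id part_zero)
  have **: "part P (if Q then frag_of t else 0) = (if P t \<and> Q then frag_of t else 0)" for P Q
    by (simp add: part_def)
  show ?thesis
    using bet_trans[of y x z "hd t"] by (auto simp: r part_diff * **)
qed

lemma tail_boundary_path_cycle: "tail_boundary y (tail_boundary_path y p) = 0"
proof (induction p arbitrary: y)
  case (Cons x r)
  show ?case
    by (cases "r = []") (auto simp: tail_boundary_diff tail_boundary_prepend Cons.IH part_tail_boundary_path)
qed simp

lemma tail_boundary_tail_boundary: "tail_boundary y (tail_boundary y c) = 0"
  by (rule linear_eqI[where c = c]) (auto simp: tail_boundary_diff tail_boundary_path_cycle)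

text \<open>
  That a path arises from another one by deleting an interior point which lies between its
  neighbours, irrespective of signs and cancellation.
\<close>

inductive is_face :: "'a list \<Rightarrow> 'a list \<Rightarrow> bool" where
  here: "bet a x b \<Longrightarrow> is_face (a # x # b # r) (a # b # r)"
| there: "is_face q p \<Longrightarrow> is_face (a # q) (a # p)"

lemma face_props: "is_face q p \<Longrightarrow> q \<noteq> [] \<and> p \<noteq> [] \<and> hd q = hd p \<and> length q = Suc (length p) \<and> set p \<subseteq> set q"
  by (induction rule: is_face.induct) auto

lemma keys_tail_boundary_path_face: "q \<in> Poly_Mapping.keys (tail_boundary_path y p) \<Longrightarrow> is_face (y # p) (y # q)"
proof (induction p arbitrary: y q)
  case (Cons x r)
  have "q \<in> Poly_Mapping.keys (if r \<noteq> [] \<and> bet y x (hd r) then frag_of r else 0) \<union> Poly_Mapping.keys (prepend x (tail_boundary_path x r))"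
    using subsetD[OF keys_diff Cons.prems[unfolded tail_boundary_path.simps]] .
  then consider "q = r" "r \<noteq> []" "bet y x (hd r)" | q' where "q = x # q'" "q' \<in> Poly_Mapping.keys (tail_boundary_path x r)"
    by (auto simp: keys_prepend split: if_splits)
  then show ?case
  proof cases
    case 1 then show ?thesis by (cases r) (auto intro: is_face.here)
  next
    case 2 then show ?thesis using is_face.there[OF Cons.IH[OF 2(2)]] by simp
  qed
qed simp

lemma keys_tail_boundary_face: "q \<in> Poly_Mapping.keys (tail_boundary y L) \<Longrightarrow> \<exists>p\<in>Poly_Mapping.keys L. is_face (y # p) (y # q)"
  using subsetD[OF keys_frag_extend[of "tail_boundary_path y" L]] by (auto simp: tail_boundary_def intro: keys_tail_boundary_path_face)

lemma face_walk: "is_face q p \<Longrightarrow> walk S q \<Longrightarrow> walk S p"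
proof (induction rule: is_face.induct)
  case (here a x b r)
  then have "a \<noteq> b" by (metis bet_same list.set_intros(1) successively.simps(3) walk_def)
  with here show ?case by (auto simp: walk_def successively_Cons)
next
  case (there q p a)
  then show ?case using face_props[OF there.hyps] by (auto simp: walk_def successively_Cons)
qed

text \<open>
  The deleted point remains strictly between two consecutive vertices of the face.
\<close>

lemma face_not_saturated: "is_face q p \<Longrightarrow> walk S q \<Longrightarrow> \<not> successively (edge S) p"
proof (induction rule: is_face.induct)
  case (here a x b r)
  then show ?case by (auto simp: walk_def edge_def)
next
  case (there q p a)
  then show ?case using face_props[OF there.hyps] by (auto simp: walk_def successively_Cons)
qed

lemma saturated_walk: "successively (edge S) p \<Longrightarrow> p \<noteq> [] \<Longrightarrow> hd p \<in> S \<Longrightarrow> walk S p"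
proof (induction p)
  case (Cons a p)
  then show ?case by (cases p) (auto simp: walk_def edge_def)
qed simp

text \<open>
  A face of a saturated path has exactly one pair of consecutive vertices that is not an edge, the
  diagonal of a square. A path with the same face must put its additional vertex there, and is
  saturated by \<open>edge_square_diagonal\<close>. For graphs this reflects the splitting of the magnitude
  complex by length: the saturated paths are those whose length equals their degree.
\<close>

lemma saturated_of_common_face:
  assumes "modular S"
  shows "is_face q p \<Longrightarrow> successively (edge S) q \<Longrightarrow> walk S q' \<Longrightarrow> is_face q' p \<Longrightarrow> successively (edge S) q'"
proof (induction arbitrary: q' rule: is_face.induct)
  case (here a x b r)
  have ne: "a \<noteq> b" using here by (auto simp: edge_def dest: bet_same)
  from \<open>is_face q' (a # b # r)\<close> show ?case
  proof cases
    case (here v)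
    then have v: "v \<in> S" "v \<noteq> a" "v \<noteq> b" using \<open>walk S q'\<close> by (auto simp: walk_def)
    have ax: "edge S a x" and xb: "edge S x b" using \<open>successively _ _\<close> by auto
    have "edge S a v"
      using edge_square_diagonal[OF assms ax xb \<open>bet a x b\<close> v(1) _ v(2,3)] here by auto
    moreover have "edge S b v"
      using edge_square_diagonal[OF assms edge_sym[OF xb] edge_sym[OF ax] bet_sym[OF \<open>bet a x b\<close>] v(1) bet_sym v(3,2)] here by auto
    ultimately show ?thesis using \<open>successively _ _\<close> here edge_sym by auto
  next
    case (there q'')
    then show ?thesis using face_not_saturated[of q'' "b # r" S] \<open>walk S q'\<close> \<open>successively _ _\<close>
      by (auto simp: walk_def successively_Cons)
  qed
next
  case (there q p a)
  have p: "p \<noteq> []" "q \<noteq> []" "hd q = hd p" using face_props[OF there.hyps] by auto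
  then have e: "edge S a (hd p)" "successively (edge S) q" using there.prems by (auto simp: successively_Cons)
  from \<open>is_face q' (a # p)\<close> show ?case
  proof cases
    case (here v b r)
    then show ?thesis using e there.prems by (auto simp: edge_def walk_def)
  next
    case (there q'')
    then have "walk S q''" using \<open>walk S q'\<close> by (auto simp: walk_def successively_Cons)
    then show ?thesis using there.IH[OF e(2)] there e face_props[of q'' p] by (auto simp: successively_Cons)
  qed
qed

section \<open>Reduction of cycles in a modular set\<close>

text \<open>
  Chains of paths \<open>y # p\<close> in \<open>S\<close> that leave \<open>y\<close> through \<open>B\<close>, represented by their tails. A path
  that leaves \<open>y\<close> through \<open>B\<close> still does so after a deletion, so these chains form a subcomplex
  for each \<open>y\<close> and \<open>B\<close>.
\<close>

definition tail_chains :: "'a set \<Rightarrow> 'a \<Rightarrow> 'a set \<Rightarrow> nat \<Rightarrow> ('a list \<Rightarrow>\<^sub>0 int) set" where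
  "tail_chains S y B n = {L. \<forall>p\<in>Poly_Mapping.keys L.
     length p = n \<and> walk S (y # p) \<and> p \<noteq> [] \<and> hd p \<in> beyond y B}"

lemma tail_chainsD:
  assumes "L \<in> tail_chains S y B n" "p \<in> Poly_Mapping.keys L"
  shows "length p = n" "walk S (y # p)" "p \<noteq> []" "hd p \<in> beyond y B"
  using assms by (auto simp: tail_chains_def)

lemma tail_chains_0 [simp]: "0 \<in> tail_chains S y B n"
  by (simp add: tail_chains_def)

lemma tail_chains_add:
  "L \<in> tail_chains S y B n \<Longrightarrow> L' \<in> tail_chains S y B n \<Longrightarrow> L + L' \<in> tail_chains S y B n"
  using keys_add[of L L'] unfolding tail_chains_def by blast

lemma tail_chains_diff:
  "L \<in> tail_chains S y B n \<Longrightarrow> L' \<in> tail_chains S y B n \<Longrightarrow> L - L' \<in> tail_chains S y B n"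
  using keys_diff[of L L'] unfolding tail_chains_def by blast

lemma tail_chains_part: "L \<in> tail_chains S y B n \<Longrightarrow> part P L \<in> tail_chains S y B n"
  by (auto simp: tail_chains_def keys_part)

lemma tail_chains_mono: "L \<in> tail_chains S y B n \<Longrightarrow> B \<subseteq> B' \<Longrightarrow> L \<in> tail_chains S y B' n"
  unfolding tail_chains_def beyond_def by blast

lemma is_face_second:
  assumes "is_face (y # x # r) (y # q)"
  shows "q \<noteq> [] \<and> (hd q = x \<or> bet y x (hd q))"
  using assms
proof cases
  case there
  then show ?thesis using face_props[of "x # r" q] by auto
qed auto

lemma tail_chains_tail_boundary:
  assumes "L \<in> tail_chains S y B (Suc n)"
  shows "tail_boundary y L \<in> tail_chains S y B n"
proof -
  have "length q = n \<and> walk S (y # q) \<and> q \<noteq> [] \<and> hd q \<in> beyond y B"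
    if "q \<in> Poly_Mapping.keys (tail_boundary y L)" for q
  proof -
    obtain p where p: "p \<in> Poly_Mapping.keys L" and f: "is_face (y # p) (y # q)"
      using keys_tail_boundary_face[OF \<open>q \<in> _\<close>] by blast
    note D = tail_chainsD[OF assms p]
    obtain x r where xr: "p = x # r" using D(3) by (cases p) auto
    obtain b where b: "b \<in> B" "bet y b x" using D(4) xr by (auto simp: beyond_def)
    have "q \<noteq> []" "hd q = x \<or> bet y x (hd q)" using is_face_second f xr by auto
    then have "bet y b (hd q)" using b bet_trans_left(2) by metis
    then show ?thesis
      using \<open>q \<noteq> []\<close> b(1) D(1) face_props[OF f] face_walk[OF f D(2)] by (auto simp: beyond_def)
  qed
  then show ?thesis by (simp add: tail_chains_def)
qed

lemma walk_ConsD: "walk S (x # p) \<Longrightarrow> walk S p"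
  by (auto simp: walk_def successively_Cons)

text \<open>
  Insert \<open>b\<close> in front of the tails that lie beyond \<open>b\<close> without starting there. In the boundary of
  the result, deleting \<open>b\<close> gives back these tails and all other terms start with \<open>b\<close>. Hence a cycle
  is homologous to a sum of tails starting with \<open>b\<close> and tails that are not beyond \<open>b\<close>. Since the
  latter contribute no boundary term starting with \<open>b\<close>, the part after \<open>b\<close> is a cycle on its own;
  and the terms arising from it by deleting \<open>b\<close> must cancel against boundaries of tails that
  leave \<open>y\<close> through \<open>B\<close>, which yields the last claim.
\<close>

lemma peel_edge:
  assumes SM: "S \<subseteq> M" and b: "edge S y b" and L: "L \<in> tail_chains S y (insert b B) (Suc n)"
    and cycle: "tail_boundary y L = 0"
  obtains w R u where "L = prepend b w + R + tail_boundary y u"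
    "prepend b w \<in> tail_chains S y {b} (Suc n)" "R \<in> tail_chains S y B (Suc n)"
    "u \<in> tail_chains S y {b} (Suc (Suc n))" "tail_boundary b w = 0"
    "\<And>q. q \<in> Poly_Mapping.keys w \<Longrightarrow> q \<noteq> [] \<Longrightarrow> bet y b (hd q) \<Longrightarrow> hd q \<in> beyond y B"
proof -
  \<comment> \<open>The three kinds of tails: strictly beyond \<open>b\<close>, starting at \<open>b\<close>, and not beyond \<open>b\<close>.\<close>
  define L1 where "L1 = part (\<lambda>p. hd p \<noteq> b \<and> bet y b (hd p)) L"
  define L2 where "L2 = part (\<lambda>p. hd p = b) L"
  define R where "R = part (\<lambda>p. hd p \<noteq> b \<and> \<not> bet y b (hd p)) L"
  define u where "u = prepend b L1"
  define w where "w = tail_boundary b L1 + tails b L2"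
  have yb: "y \<in> S" "b \<in> S" "y \<noteq> b" using b by (auto simp: edge_def)
  have ybb: "bet y b b" using bet_refl bet_sym yb SM by blast
  have sum: "L = L1 + L2 + R"
    by (rule poly_mapping_eqI) (auto simp: L1_def L2_def R_def lookup_add lookup_part)
  have "part (\<lambda>p. p \<noteq> [] \<and> hd p = b) L2 = L2"
    using tail_chainsD(3)[OF L] by (intro part_id) (auto simp: L2_def keys_part)
  then have L2: "prepend b (tails b L2) = L2" by (simp add: prepend_tails)
  have "part (\<lambda>r. r \<noteq> [] \<and> bet y b (hd r)) L1 = L1"
    using tail_chainsD(3)[OF L] by (intro part_id) (auto simp: L1_def keys_part)
  then have "tail_boundary y u = L1 - prepend b (tail_boundary b L1)" by (simp add: u_def tail_boundary_prepend)
  then have decomp: "L = prepend b w + R + tail_boundary y u"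
    by (simp add: sum w_def prepend_add L2)
  have L1_walk: "walk S (b # p)" "length p = Suc n" if "p \<in> Poly_Mapping.keys L1" for p
    using that tail_chainsD[OF L, of p] yb by (auto simp: L1_def keys_part walk_def successively_Cons)
  have u: "u \<in> tail_chains S y {b} (Suc (Suc n))"
    using L1_walk yb ybb by (auto simp: u_def tail_chains_def keys_prepend beyond_def walk_def)
  have "walk S (y # b # q) \<and> length q = n" if "q \<in> Poly_Mapping.keys w" for q
  proof -
    have "q \<in> Poly_Mapping.keys (tail_boundary b L1) \<or> q \<in> Poly_Mapping.keys (tails b L2)"
      using that keys_add[of "tail_boundary b L1" "tails b L2"] by (auto simp: w_def)
    then show ?thesis
    proof
      assume "q \<in> Poly_Mapping.keys (tail_boundary b L1)"
      then obtain p where p: "p \<in> Poly_Mapping.keys L1" "is_face (b # p) (b # q)"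
        using keys_tail_boundary_face by blast
      then show ?thesis
        using L1_walk[OF p(1)] face_walk[OF p(2)] face_props[OF p(2)] yb by (auto simp: walk_def)
    next
      assume "q \<in> Poly_Mapping.keys (tails b L2)"
      then have "b # q \<in> Poly_Mapping.keys L" by (simp add: keys_tails L2_def keys_part)
      then show ?thesis using tail_chainsD[OF L] by fastforce
    qed
  qed
  then have w: "prepend b w \<in> tail_chains S y {b} (Suc n)" and w_hd: "q \<in> Poly_Mapping.keys w \<Longrightarrow> q \<noteq> [] \<Longrightarrow> hd q \<noteq> b" for q
    using ybb by (auto simp: tail_chains_def keys_prepend beyond_def walk_def successively_Cons)
  have R: "R \<in> tail_chains S y B (Suc n)"
    using L by (auto simp: R_def tail_chains_def keys_part beyond_def)
  have "tail_boundary y (prepend b w + R) = 0"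
    using cycle by (simp add: decomp tail_boundary_add tail_boundary_tail_boundary)
  then have eq: "prepend b (tail_boundary b w) = part (\<lambda>r. r \<noteq> [] \<and> bet y b (hd r)) w + tail_boundary y R"
    by (simp add: tail_boundary_add tail_boundary_prepend algebra_simps)
  have R_hd: "b # q \<notin> Poly_Mapping.keys (tail_boundary y R)" for q
  proof
    assume "b # q \<in> Poly_Mapping.keys (tail_boundary y R)"
    then obtain p where p: "p \<in> Poly_Mapping.keys R" "is_face (y # p) (y # b # q)"
      using keys_tail_boundary_face by blast
    note D = tail_chainsD[OF R p(1)]
    obtain x r where xr: "p = x # r" using D(3) by (cases p) auto
    have "x \<noteq> b" using p(1) xr by (simp add: R_def keys_part)
    moreover have "x \<in> S" "x \<noteq> y" using D(2) by (auto simp: walk_def xr)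
    moreover have "x = b \<or> bet y x b" using is_face_second[of y x r "b # q"] p(2) xr by auto
    ultimately show False using b by (auto simp: edge_def)
  qed
  have cyc: "tail_boundary b w = 0"
  proof (rule poly_mapping_eqI)
    fix q
    have "poly_mapping.lookup (tail_boundary b w) q = poly_mapping.lookup (prepend b (tail_boundary b w)) (b # q)"
      by (simp add: lookup_prepend_Cons)
    also have "\<dots> = 0"
      unfolding eq using R_hd[of q] w_hd[of "b # q"] by (auto simp: lookup_add lookup_part in_keys_iff)
    finally show "poly_mapping.lookup (tail_boundary b w) q = poly_mapping.lookup 0 q" by simp
  qed
  have "hd q \<in> beyond y B" if "q \<in> Poly_Mapping.keys w" "q \<noteq> []" "bet y b (hd q)" for q
  proof -
    have "poly_mapping.lookup w q + poly_mapping.lookup (tail_boundary y R) q = 0"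
      using arg_cong[OF eq, of "\<lambda>c. poly_mapping.lookup c q"] cyc that(2,3)
      by (simp add: lookup_add lookup_part)
    then have "q \<in> Poly_Mapping.keys (tail_boundary y R)" using that(1) by (auto simp: in_keys_iff)
    then show ?thesis using tail_chainsD(4)[OF tail_chains_tail_boundary[OF R]] by blast
  qed
  then show thesis using that decomp w R u cyc by blast
qed

text \<open>
  The edges at \<open>b\<close> through which the tail after \<open>b\<close> produced by \<open>peel_edge\<close> can leave \<open>b\<close>: back
  to \<open>y\<close>, or to the corner opposite to \<open>y\<close> in a square containing \<open>b\<close> and a point of \<open>B\<close>.
\<close>

definition exits :: "'a set \<Rightarrow> 'a \<Rightarrow> 'a \<Rightarrow> 'a set \<Rightarrow> 'a set" where
  "exits S y b B = insert y {c. edge S b c \<and> bet y b c \<and> (\<exists>b'\<in>B. bet y b' c)}"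

lemma exits_edges: "edge S y b \<Longrightarrow> c \<in> exits S y b B \<Longrightarrow> edge S b c"
  using edge_sym by (auto simp: exits_def)

lemma beyond_exits:
  assumes S: "modular S" and b: "edge S y b" and B: "\<And>b'. b' \<in> B \<Longrightarrow> edge S y b'" "b \<notin> B"
    and x: "x \<in> S" "bet y b x \<Longrightarrow> x \<in> beyond y B"
  shows "x \<in> beyond b (exits S y b B)"
proof (cases "bet y b x")
  case True
  then obtain b' where b': "b' \<in> B" "bet y b' x" using x(2) by (auto simp: beyond_def)
  then have "b \<noteq> b'" using B(2) by auto
  then obtain c where "edge S b c" "bet y b c" "bet y b' c" "bet b c x"
    using edge_join[OF S b B(1)[OF b'(1)] _ x(1) True b'(2)] by blast
  then show ?thesis using b'(1) by (auto simp: beyond_def exits_def)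
next
  case False
  then show ?thesis using edge_dichotomy[OF S b x(1)] by (auto simp: beyond_def exits_def)
qed

text \<open>
  The converse direction: when \<open>b\<close> is deleted from a path \<open>y # b # x # _\<close> that left \<open>b\<close> through one
  of its exits, the result leaves \<open>y\<close> through \<open>B\<close>. So such terms are handled by the induction
  on \<open>B\<close>.
\<close>

lemma beyond_exits_return:
  assumes "edge S y b" "x \<in> beyond b (exits S y b B)" "bet y b x"
  shows "x \<in> beyond y B"
proof -
  obtain c where c: "c \<in> exits S y b B" "bet b c x" using assms(2) by (auto simp: beyond_def)
  have "c \<noteq> y"
    using c(2) assms(1,3) bet_sym bet_antisym unfolding edge_def by metis
  then obtain b' where b': "b' \<in> B" "bet y b' c" using c(1) by (auto simp: exits_def)
  have "bet y c x" using bet_trans_right(2)[OF c(2) assms(3)] .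
  then have "bet y b' x" using bet_trans_left(2)[OF b'(2)] by blast
  then show ?thesis using b'(1) by (auto simp: beyond_def)
qed

text \<open>
  Boundaries of saturated and of unsaturated chains have disjoint supports, so they cannot cancel
  each other.
\<close>

lemma unsaturated_part_cycle:
  assumes S: "modular S" and s: "\<forall>p\<in>Poly_Mapping.keys s. successively (edge S) (y # p)"
    and v: "v \<in> tail_chains S y B n" "\<forall>p\<in>Poly_Mapping.keys v. \<not> successively (edge S) (y # p)"
    and cycle: "tail_boundary y (s + v) = 0"
  shows "tail_boundary y v = 0"
proof (rule ccontr)
  assume "tail_boundary y v \<noteq> 0"
  then obtain q where q: "q \<in> Poly_Mapping.keys (tail_boundary y v)" by fastforce
  have "tail_boundary y s = - tail_boundary y v" using cycle by (simp add: tail_boundary_add eq_neg_iff_add_eq_0)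
  then have "q \<in> Poly_Mapping.keys (tail_boundary y s)" using q by simp
  then obtain p where p: "p \<in> Poly_Mapping.keys s" "is_face (y # p) (y # q)" using keys_tail_boundary_face by blast
  obtain p' where p': "p' \<in> Poly_Mapping.keys v" "is_face (y # p') (y # q)" using keys_tail_boundary_face q by blast
  show False
    using saturated_of_common_face[OF S p(2)] s p(1) tail_chainsD(2)[OF v(1) p'(1)] p'(2) v(2) p'(1) by blast
qed

text \<open>
  Lexicographic induction on the length of the tails and on the set \<open>B\<close> of directions in which they
  leave \<open>y\<close>.
\<close>

lemma cycle_homologous_to_saturated:
  assumes S: "modular S"
  shows "\<lbrakk>\<forall>b\<in>B. edge S y b; L \<in> tail_chains S y B n; tail_boundary y L = 0\<rbrakk> \<Longrightarrow>
    \<exists>s u. s \<in> tail_chains S y B n \<and> u \<in> tail_chains S y B (Suc n) \<and> L = s + tail_boundary y u \<and>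
      (\<forall>p\<in>Poly_Mapping.keys s. successively (edge S) (y # p))"
proof (induction n arbitrary: y B L)
  case 0
  then have "Poly_Mapping.keys L = {}" by (fastforce simp: tail_chains_def)
  then show ?case using tail_chains_0 by (intro exI[of _ 0]) auto
next
  case (Suc n)
  have SM: "S \<subseteq> M" using S by (simp add: modular_def)
  have fin: "\<exists>s u. s \<in> tail_chains S y B (Suc n) \<and> u \<in> tail_chains S y B (Suc (Suc n)) \<and> L = s + tail_boundary y u \<and>
      (\<forall>p\<in>Poly_Mapping.keys s. successively (edge S) (y # p))"
    if "finite B" "\<forall>b\<in>B. edge S y b" "L \<in> tail_chains S y B (Suc n)" "tail_boundary y L = 0" for B L
    using that
  proof (induction B arbitrary: L rule: finite_induct)
    case empty
    then have "Poly_Mapping.keys L = {}" by (auto simp: tail_chains_def beyond_def)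
    then show ?case using tail_chains_0 by (intro exI[of _ 0]) auto
  next
    case (insert b B)
    have b: "edge S y b" and B: "\<And>b'. b' \<in> B \<Longrightarrow> edge S y b'" using insert.prems by auto
    then have yb: "y \<in> S" "b \<in> S" "y \<noteq> b" by (auto simp: edge_def)
    have ybb: "bet y b b" using bet_refl bet_sym yb SM by blast
    obtain w R u where L: "L = prepend b w + R + tail_boundary y u"
      and w: "prepend b w \<in> tail_chains S y {b} (Suc n)" and R: "R \<in> tail_chains S y B (Suc n)"
      and u: "u \<in> tail_chains S y {b} (Suc (Suc n))" and wcyc: "tail_boundary b w = 0"
      and w_beyond: "\<And>q. q \<in> Poly_Mapping.keys w \<Longrightarrow> q \<noteq> [] \<Longrightarrow> bet y b (hd q) \<Longrightarrow> hd q \<in> beyond y B"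
      using peel_edge[OF SM b insert.prems(2,3)] by blast
    have wk: "length p = n \<and> walk S (b # p)" if "p \<in> Poly_Mapping.keys w" for p
      using tail_chainsD[OF w, of "b # p"] that walk_ConsD by (auto simp: keys_prepend)
    let ?E = "exits S y b B"
    have "\<exists>s' u'. w = s' + tail_boundary b u' \<and> u' \<in> tail_chains S b ?E (Suc n) \<and>
        (\<forall>p\<in>Poly_Mapping.keys s'. length p = n \<and> successively (edge S) (b # p))"
    proof (cases "n = 0")
      case True
      then have "\<forall>p\<in>Poly_Mapping.keys w. p = []" using wk by auto
      with True show ?thesis by - (rule exI[where x = w], rule exI[where x = 0], auto)
    next
      case False
      have "p \<noteq> [] \<and> hd p \<in> beyond b ?E" if p: "p \<in> Poly_Mapping.keys w" for p
      proof -
        have "p \<noteq> []" using wk[OF p] False by auto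
        moreover have "hd p \<in> S" using wk[OF p] \<open>p \<noteq> []\<close> by (auto simp: walk_def)
        ultimately show ?thesis
          using beyond_exits[OF S b B insert.hyps(2)] w_beyond[OF p] by blast
      qed
      then have "w \<in> tail_chains S b ?E n" using wk by (simp add: tail_chains_def)
      then show ?thesis
        using Suc.IH[of ?E b w] wcyc exits_edges[OF b] tail_chainsD(1) by blast
    qed
    then obtain s' u' where w_eq: "w = s' + tail_boundary b u'" and u': "u' \<in> tail_chains S b ?E (Suc n)"
      and s': "\<forall>p\<in>Poly_Mapping.keys s'. length p = n \<and> successively (edge S) (b # p)" by blast
    \<comment> \<open>Bounding the part after \<open>b\<close> bounds the tails starting with \<open>b\<close> up to
        tails from which \<open>b\<close> has been deleted, and these leave \<open>y\<close> through \<open>B\<close>.\<close>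
    define v where "v = part (\<lambda>r. r \<noteq> [] \<and> bet y b (hd r)) u' + R"
    define vs where "vs = part (\<lambda>p. successively (edge S) (y # p)) v"
    define vn where "vn = part (\<lambda>p. \<not> successively (edge S) (y # p)) v"
    define s1 where "s1 = prepend b s' + vs"
    have v_split: "v = vs + vn" by (simp add: vs_def vn_def part_add_part_not)
    have "prepend b (tail_boundary b u') = part (\<lambda>r. r \<noteq> [] \<and> bet y b (hd r)) u' - tail_boundary y (prepend b u')"
      by (simp add: tail_boundary_prepend)
    then have "L = prepend b s' + v + tail_boundary y (u - prepend b u')"
      by (simp add: L w_eq v_def prepend_add tail_boundary_diff)
    then have L': "L = s1 + vn + tail_boundary y (u - prepend b u')"
      by (simp add: s1_def v_split add.assoc)
    have u'_in: "prepend b u' \<in> tail_chains S y {b} (Suc (Suc n))"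
      using tail_chainsD[OF u'] yb ybb
      by (auto simp: tail_chains_def keys_prepend beyond_def walk_def)
    have "part (\<lambda>r. r \<noteq> [] \<and> bet y b (hd r)) u' \<in> tail_chains S y B (Suc n)"
    proof -
      have "length p = Suc n \<and> walk S (y # p) \<and> p \<noteq> [] \<and> hd p \<in> beyond y B"
        if p: "p \<in> Poly_Mapping.keys u'" "bet y b (hd p)" for p
      proof -
        note D = tail_chainsD[OF u' p(1)]
        have "hd p \<noteq> y" using p(2) bet_same yb by metis
        then show ?thesis
          using D yb beyond_exits_return[OF b D(4) p(2)] by (auto simp: walk_def successively_Cons)
      qed
      then show ?thesis by (simp add: tail_chains_def keys_part)
    qed
    then have v: "v \<in> tail_chains S y B (Suc n)" using R by (simp add: v_def tail_chains_add)
    then have vs: "vs \<in> tail_chains S y B (Suc n)" and vn: "vn \<in> tail_chains S y B (Suc n)"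
      by (simp_all add: vs_def vn_def tail_chains_part)
    have s'_in: "prepend b s' \<in> tail_chains S y {b} (Suc n)"
      using s' yb ybb saturated_walk[of S "b # _"]
      by (auto simp: tail_chains_def keys_prepend beyond_def walk_def)
    have s1_edges: "\<forall>p\<in>Poly_Mapping.keys s1. successively (edge S) (y # p)"
      using s' b keys_add[of "prepend b s'" vs] by (force simp: s1_def keys_prepend vs_def keys_part)
    \<comment> \<open>The chain \<open>v\<close> need not be a cycle, but its unsaturated part is.\<close>
    have "tail_boundary y (s1 + vn) = 0"
      using insert.prems(3) by (simp add: L' tail_boundary_add tail_boundary_tail_boundary)
    then have "tail_boundary y vn = 0"
      using unsaturated_part_cycle[OF S s1_edges vn] by (simp add: vn_def keys_part)
    then obtain s2 u2 where IH: "s2 \<in> tail_chains S y B (Suc n)" "u2 \<in> tail_chains S y B (Suc (Suc n))"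
      "vn = s2 + tail_boundary y u2" "\<forall>p\<in>Poly_Mapping.keys s2. successively (edge S) (y # p)"
      using insert.IH[of vn] vn B by blast
    show ?case
    proof (intro exI conjI)
      show "L = (s1 + s2) + tail_boundary y (u - prepend b u' + u2)"
        by (simp add: L' IH(3) tail_boundary_add tail_boundary_diff)
      show "s1 + s2 \<in> tail_chains S y (insert b B) (Suc n)"
        unfolding s1_def
        by (intro tail_chains_add tail_chains_mono[OF s'_in] tail_chains_mono[OF vs] tail_chains_mono[OF IH(1)]) auto
      show "u - prepend b u' + u2 \<in> tail_chains S y (insert b B) (Suc (Suc n))"
        by (intro tail_chains_add tail_chains_diff tail_chains_mono[OF u] tail_chains_mono[OF u'_in]
            tail_chains_mono[OF IH(2)]) auto
      show "\<forall>p\<in>Poly_Mapping.keys (s1 + s2). successively (edge S) (y # p)"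
        using keys_add[of s1 s2] s1_edges IH(4) by blast
    qed
  qed
  \<comment> \<open>The set \<open>exits S y b B\<close> may be infinite even if \<open>B\<close> is finite, but only finitely
      many of its points matter for a given chain.\<close>
  have "\<forall>p\<in>Poly_Mapping.keys L. \<exists>b\<in>B. bet y b (hd p)"
    using tail_chainsD(4)[OF Suc.prems(2)] by (auto simp: beyond_def)
  then obtain f where f: "\<forall>p\<in>Poly_Mapping.keys L. f p \<in> B \<and> bet y (f p) (hd p)" by metis
  let ?B = "f ` Poly_Mapping.keys L"
  have "?B \<subseteq> B" "finite ?B" using f by auto
  moreover have "L \<in> tail_chains S y ?B (Suc n)"
    using Suc.prems(2) f by (auto simp: tail_chains_def beyond_def)
  ultimately show ?case
    using fin[of ?B L] Suc.prems tail_chains_mono[OF _ \<open>?B \<subseteq> B\<close>] by blast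
qed

text \<open>
  No path in a boundary is saturated by \<open>face_not_saturated\<close>, so the saturated chain homologous to a
  cycle consists of paths that already occur in the cycle.
\<close>

lemma cycle_homologous_to_saturated_part:
  assumes S: "modular S" and B: "\<forall>b\<in>B. edge S y b" and L: "L \<in> tail_chains S y B n"
    and cycle: "tail_boundary y L = 0"
  obtains s u where "u \<in> tail_chains S y B (Suc n)" "L = s + tail_boundary y u"
    "Poly_Mapping.keys s \<subseteq> Poly_Mapping.keys L" "\<forall>p\<in>Poly_Mapping.keys s. successively (edge S) (y # p)"
proof -
  obtain s u where s: "s \<in> tail_chains S y B n" and u: "u \<in> tail_chains S y B (Suc n)"
    and eq: "L = s + tail_boundary y u" and edges: "\<forall>p\<in>Poly_Mapping.keys s. successively (edge S) (y # p)"
    using cycle_homologous_to_saturated[OF S B L cycle] by blast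
  have "p \<in> Poly_Mapping.keys L" if p: "p \<in> Poly_Mapping.keys s" for p
  proof -
    have "p \<notin> Poly_Mapping.keys (tail_boundary y u)"
    proof
      assume "p \<in> Poly_Mapping.keys (tail_boundary y u)"
      then obtain q where "q \<in> Poly_Mapping.keys u" "is_face (y # q) (y # p)" using keys_tail_boundary_face by blast
      then show False using face_not_saturated tail_chainsD(2)[OF u] edges p by blast
    qed
    then show ?thesis using p by (simp add: eq in_keys_iff lookup_add)
  qed
  then show thesis using that u eq edges by blast
qed

section \<open>Modular subsets of a median space\<close>

definition median :: bool where
  "median \<longleftrightarrow> (\<forall>x\<in>M. \<forall>y\<in>M. \<forall>z\<in>M. \<exists>!m. bet x m y \<and> bet y m z \<and> bet x m z)"

lemma medianE:
  assumes median "x \<in> M" "y \<in> M" "z \<in> M"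
  obtains m where "bet x m y" "bet y m z" "bet x m z"
  using assms unfolding median_def by blast

lemma median_unique:
  assumes median "bet x m y" "bet y m z" "bet x m z" "bet x m' y" "bet y m' z" "bet x m' z"
  shows "m = m'"
proof -
  have "x \<in> M" "y \<in> M" "z \<in> M" using assms(2,3) bet_carrier by blast+
  then show ?thesis using assms unfolding median_def by blast
qed

text \<open>
  Halfspaces are convex. Project \<open>u\<close> towards \<open>x\<close> and \<open>x'\<close>, obtaining \<open>t\<close> and \<open>t'\<close> between \<open>y\<close>
  and \<open>u\<close>. The median \<open>s\<close> of \<open>y\<close>, \<open>t\<close> and \<open>t'\<close> lies between \<open>y\<close> and \<open>u\<close>, and it is also a
  median of \<open>y\<close>, \<open>x\<close> and \<open>x'\<close>; so is the median \<open>q\<close> of \<open>b\<close>, \<open>x\<close> and \<open>x'\<close>, behind \<open>b\<close>.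
  By uniqueness \<open>q = s\<close>, which puts \<open>b\<close> between \<open>y\<close> and \<open>u\<close>.
\<close>

lemma median_convex:
  assumes med: median and x: "bet y b x" and x': "bet y b x'" and u: "bet x u x'"
  shows "bet y b u"
proof -
  have M: "y \<in> M" "b \<in> M" "x \<in> M" "x' \<in> M" "u \<in> M" using bet_carrier x x' u by blast+
  obtain t where t: "bet y t u" "bet u t x" "bet y t x" using medianE[OF med M(1,5,3)] .
  obtain t' where t': "bet y t' u" "bet u t' x'" "bet y t' x'" using medianE[OF med M(1,5,4)] .
  have "t \<in> M" "t' \<in> M" using bet_carrier t t' by blast+
  then obtain s where s: "bet y s t" "bet t s t'" "bet y s t'" using medianE[OF med M(1)] by blast
  obtain q where q: "bet b q x" "bet x q x'" "bet b q x'" using medianE[OF med M(2-4)] .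
  have "bet t u x'" "bet x t x'" using bet_trans_left[OF bet_sym[OF t(2)] u] .
  have "bet t t' x'" using bet_trans_right(2)[OF t'(2) \<open>bet t u x'\<close>] .
  then have "bet t s x'" by (rule bet_trans_left(2)[OF s(2)])
  then have "bet x s x'" using \<open>bet x t x'\<close> by (rule bet_trans_right(2))
  moreover have "bet y s x" "bet y s x'"
    using bet_trans_left(2)[OF s(1) t(3)] bet_trans_left(2)[OF s(3) t'(3)] .
  moreover have q': "bet y b q" "bet y q x" "bet y q x'"
    using bet_trans_right[OF q(1) x] bet_trans_right[OF q(3) x'] by auto
  ultimately have "q = s" using median_unique[OF med, of y q x x' s] q(2) by blast
  then have "bet y b s" using q'(1) by simp
  moreover have "bet y s u" using bet_trans_left(2)[OF s(1) t(1)] .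
  ultimately show ?thesis by (rule bet_trans_left(2))
qed

text \<open>
  Each pair \<open>(y, b)\<close> cuts the set into two convex sides. Among three points two are on the same
  side, and the median lies between these two.
\<close>

lemma median_cuts_modular:
  assumes med: median
  shows "modular {x \<in> M. \<forall>b\<in>B. bet y b x \<or> bet b y x}" (is "modular ?S")
proof -
  have "\<exists>m\<in>?S. bet x1 m x2 \<and> bet x2 m x3 \<and> bet x1 m x3"
    if S: "x1 \<in> ?S" "x2 \<in> ?S" "x3 \<in> ?S" for x1 x2 x3
  proof -
    obtain m where m: "bet x1 m x2" "bet x2 m x3" "bet x1 m x3"
      using medianE[OF med] S by blast
    have "bet y b m \<or> bet b y m" if "b \<in> B" for b
    proof -
      have "bet y b x1 \<or> bet b y x1" "bet y b x2 \<or> bet b y x2" "bet y b x3 \<or> bet b y x3"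
        using S \<open>b \<in> B\<close> by auto
      then show ?thesis
        using median_convex[OF med _ _ m(1)] median_convex[OF med _ _ m(2)] median_convex[OF med _ _ m(3)]
        by blast
    qed
    then have "m \<in> ?S" using m(1) bet_carrier by blast
    then show ?thesis using m by blast
  qed
  then show ?thesis unfolding modular_def by blast
qed

text \<open>
  Move \<open>b\<close> from \<open>z\<close> towards \<open>y\<close>, replacing it by its median with \<open>y\<close> and a point of \<open>F\<close> whenever
  that median is a third point; the property survives all later moves towards \<open>y\<close>.
\<close>

lemma median_initial_point:
  assumes med: median and F: "finite F" "F \<subseteq> M" and "y \<in> M" "z \<in> M" "z \<noteq> y"
  shows "\<exists>b. b \<noteq> y \<and> bet y b z \<and> (\<forall>x\<in>F. bet y b x \<or> bet b y x)"
  using F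
proof (induction F rule: finite_induct)
  case empty
  then show ?case using assms bet_refl bet_sym by blast
next
  case (insert x F)
  then obtain b where b: "b \<noteq> y" "bet y b z" "\<forall>x\<in>F. bet y b x \<or> bet b y x" by auto
  show ?case
  proof (cases "bet y b x \<or> bet b y x")
    case True then show ?thesis using b by blast
  next
    case False
    have "b \<in> M" "x \<in> M" using b bet_carrier insert.prems by auto
    then obtain m where m: "bet y m b" "bet b m x" "bet y m x"
      using medianE[OF med \<open>y \<in> M\<close>] by blast
    have "m \<noteq> y" using m(2) False by auto
    moreover have "bet y m z" using bet_trans_left(2)[OF m(1) b(2)] .
    moreover have "bet y m v \<or> bet m y v" if "bet y b v \<or> bet b y v" for v
      using that bet_trans_left(2)[OF m(1)] bet_trans_left(1)[OF bet_sym[OF m(1)]] by blast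
    ultimately show ?thesis using b(3) m(3) by blast
  qed
qed

text \<open>
  Treat the targets one after another. The set \<open>F\<close> in \<open>median_initial_point\<close> also contains the
  points chosen before, which keeps them compatible with the new point \<open>b\<close>; those that lie beyond
  \<open>b\<close> are replaced by \<open>b\<close>.
\<close>

lemma median_initial_points:
  assumes med: median and F: "finite F" "F \<subseteq> M" and y: "y \<in> M" and "finite G" "G \<subseteq> F"
  shows "\<exists>B. finite B \<and> B \<subseteq> M - {y} \<and> (\<forall>b\<in>B. \<forall>x\<in>F \<union> B. bet y b x \<or> bet b y x) \<and>
    (\<forall>z\<in>G. z \<noteq> y \<longrightarrow> z \<in> beyond y B)"
  using \<open>finite G\<close> \<open>G \<subseteq> F\<close>
proof (induction G rule: finite_induct)
  case empty
  then show ?case by (intro exI[of _ "{}"]) auto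
next
  case (insert z G)
  then have "G \<subseteq> F" by simp
  from insert.IH[OF this] obtain B where B: "finite B" "B \<subseteq> M - {y}" "\<forall>b\<in>B. \<forall>x\<in>F \<union> B. bet y b x \<or> bet b y x"
    "\<forall>z\<in>G. z \<noteq> y \<longrightarrow> z \<in> beyond y B" by (elim exE conjE) (rule that)
  show ?case
  proof (cases "z = y \<or> z \<in> beyond y B")
    case True
    then have "\<forall>x\<in>insert z G. x \<noteq> y \<longrightarrow> x \<in> beyond y B" using B(4) by auto
    then show ?thesis by (intro exI[of _ B] conjI B(1-3))
  next
    case False
    have "z \<in> M" using insert.prems F by auto
    have "\<exists>b. b \<noteq> y \<and> bet y b z \<and> (\<forall>x\<in>F \<union> B. bet y b x \<or> bet b y x)"
      by (rule median_initial_point[OF med _ _ y \<open>z \<in> M\<close>]) (use F B(1,2) False in auto)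
    then obtain b where b: "b \<noteq> y" "bet y b z" "\<forall>x\<in>F \<union> B. bet y b x \<or> bet b y x" by blast
    then have bM: "b \<in> M" using bet_carrier by blast
    let ?B = "insert b {b' \<in> B. \<not> bet y b b'}"
    have ybb: "bet y b b" using bM y bet_refl bet_sym by blast
    have opp: "bet b y b'" if "b' \<in> ?B" "b' \<noteq> b" for b'
      using b(3) that by blast
    have dich: "bet y b' x \<or> bet b' y x" if "b' \<in> ?B" "x \<in> F \<union> ?B" for b' x
    proof (cases "b' = b")
      case True
      then show ?thesis using b(3) ybb that(2) by blast
    next
      case False
      then show ?thesis using B(3) that bet_sym[OF opp[OF that(1)]] by blast
    qed
    have beyond_B: "x \<in> beyond y ?B" if x: "x \<in> beyond y B" for x
    proof -
      obtain b' where b': "b' \<in> B" "bet y b' x" using x by (auto simp: beyond_def)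
      show ?thesis
      proof (cases "bet y b b'")
        case True
        then show ?thesis using bet_trans_left(2)[OF True b'(2)] by (simp add: beyond_def)
      qed (use b' in \<open>auto simp: beyond_def\<close>)
    qed
    show ?thesis
    proof (intro exI[of _ ?B] conjI ballI impI)
      show "finite ?B" "?B \<subseteq> M - {y}" using B(1,2) bM b(1) by auto
      show "x \<in> beyond y ?B" if "x \<in> insert z G" "x \<noteq> y" for x
      proof (cases "x = z")
        case True then show ?thesis using b(2) by (simp add: beyond_def)
      next
        case False then show ?thesis using beyond_B B(4) that by blast
      qed
    qed (rule dich)
  qed
qed

text \<open>
  Modular subsets that contain \<open>F\<close> and in which \<open>F\<close> is reached from \<open>y\<close> through edges. The whole
  space would not do: in the real line no two points form an edge.
\<close>

lemma finite_in_modular_with_edges: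
  assumes med: median and F: "finite F" "F \<subseteq> M" and y: "y \<in> M"
  obtains S B where "modular S" "F \<subseteq> S" "y \<in> S" "\<forall>b\<in>B. edge S y b" "F - {y} \<subseteq> beyond y B"
proof -
  obtain B where "finite B" and B: "B \<subseteq> M - {y}" "\<forall>b\<in>B. \<forall>x\<in>F \<union> B. bet y b x \<or> bet b y x"
    "\<forall>z\<in>F. z \<noteq> y \<longrightarrow> z \<in> beyond y B"
    using median_initial_points[OF med F y F(1) subset_refl] by (elim exE conjE) (rule that)
  define S where "S = {x \<in> M. \<forall>b\<in>B. bet y b x \<or> bet b y x}"
  have "y \<in> S" using y B(1) by (auto simp: S_def intro: bet_sym[OF bet_refl])
  have "F \<subseteq> S" using F(2) B(2) by (auto simp: S_def)
  have edges: "edge S y b" if b: "b \<in> B" for b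
  proof -
    have "u = y \<or> u = b" if u: "u \<in> S" "bet y u b" for u
    proof -
      have "bet y b u \<or> bet b y u" using u(1) b unfolding S_def by blast
      then show ?thesis using u(2) bet_antisym bet_sym by metis
    qed
    moreover have "b \<in> S" using b B(1,2) by (auto simp: S_def)
    ultimately show ?thesis using \<open>y \<in> S\<close> B(1) b by (auto simp: edge_def)
  qed
  have "modular S" using median_cuts_modular[OF med] unfolding S_def .
  moreover have "F - {y} \<subseteq> beyond y B" using B(3) by auto
  ultimately show thesis using that[of S B] \<open>F \<subseteq> S\<close> \<open>y \<in> S\<close> edges by simp
qed

text \<open>
  Enlarge \<open>X\<close> by one point strictly between \<open>a\<close> and \<open>b\<close> for each pair in \<open>X\<close> that admits one.
\<close>

lemma finite_with_separating_points:
  assumes "finite X" "X \<subseteq> M"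
  obtains F where "finite F" "X \<subseteq> F" "F \<subseteq> M"
    "\<And>S a b. F \<subseteq> S \<Longrightarrow> edge S a b \<Longrightarrow> a \<in> X \<Longrightarrow> b \<in> X \<Longrightarrow> edge M a b"
proof -
  define P where "P = {(a, b) \<in> X \<times> X. \<exists>v. bet a v b \<and> v \<noteq> a \<and> v \<noteq> b}"
  have "\<forall>ab\<in>P. \<exists>v. bet (fst ab) v (snd ab) \<and> v \<noteq> fst ab \<and> v \<noteq> snd ab" by (auto simp: P_def)
  then obtain f where f: "\<forall>ab\<in>P. bet (fst ab) (f ab) (snd ab) \<and> f ab \<noteq> fst ab \<and> f ab \<noteq> snd ab" by metis
  have "finite P" using assms(1) by (auto simp: P_def intro: finite_subset[of _ "X \<times> X"])
  show thesis
  proof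
    show "finite (X \<union> f ` P)" using assms(1) \<open>finite P\<close> by simp
    show "X \<union> f ` P \<subseteq> M" using assms(2) f bet_carrier by blast
    fix S a b assume *: "X \<union> f ` P \<subseteq> S" "edge S a b" "a \<in> X" "b \<in> X"
    have "(a, b) \<notin> P"
    proof
      assume "(a, b) \<in> P"
      then have "bet a (f (a, b)) b" "f (a, b) \<noteq> a" "f (a, b) \<noteq> b" "f (a, b) \<in> S" using f *(1) by force+
      then show False using *(2) unfolding edge_def by blast
    qed
    then show "edge M a b" using * assms(2) unfolding edge_def P_def by blast
  qed simp
qed

lemma median_tail_cycle:
  assumes med: median and y: "y \<in> M" and cycle: "tail_boundary y L = 0"
    and L: "\<forall>p\<in>Poly_Mapping.keys L. length p = n \<and> walk M (y # p) \<and> p \<noteq> []"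
  obtains s u where "L = s + tail_boundary y u" "Poly_Mapping.keys s \<subseteq> Poly_Mapping.keys L"
    "\<forall>p\<in>Poly_Mapping.keys s. successively (edge M) (y # p)"
    "\<forall>p\<in>Poly_Mapping.keys u. length p = Suc n \<and> walk M (y # p)"
proof -
  define X where "X = insert y (\<Union>p\<in>Poly_Mapping.keys L. set p)"
  have X: "finite X" "X \<subseteq> M" using y L by (auto simp: X_def walk_def)
  obtain F where F: "finite F" "X \<subseteq> F" "F \<subseteq> M"
    "\<And>S a b. F \<subseteq> S \<Longrightarrow> edge S a b \<Longrightarrow> a \<in> X \<Longrightarrow> b \<in> X \<Longrightarrow> edge M a b"
    using finite_with_separating_points[OF X] by blast
  obtain S B where S: "modular S" "F \<subseteq> S" "y \<in> S" and B: "\<forall>b\<in>B. edge S y b" "F - {y} \<subseteq> beyond y B"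
    using finite_in_modular_with_edges[OF med F(1,3) y] by blast
  have "walk S (y # p) \<and> hd p \<in> beyond y B" if p: "p \<in> Poly_Mapping.keys L" for p
  proof -
    have "set p \<subseteq> X" using p by (auto simp: X_def)
    moreover have "p \<noteq> []" "hd p \<noteq> y" "successively (\<noteq>) (y # p)" using L p by (auto simp: walk_def successively_Cons)
    moreover have "hd p \<in> F - {y}" using calculation(1-3) F(2) by (simp add: subset_iff)
    ultimately show ?thesis using S F(2) B(2) by (auto simp: walk_def)
  qed
  then have "L \<in> tail_chains S y B n" using L by (simp add: tail_chains_def)
  then obtain s u where u: "u \<in> tail_chains S y B (Suc n)" and eq: "L = s + tail_boundary y u"
    and s: "Poly_Mapping.keys s \<subseteq> Poly_Mapping.keys L" "\<forall>p\<in>Poly_Mapping.keys s. successively (edge S) (y # p)"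
    using cycle_homologous_to_saturated_part[OF S(1) B(1) _ cycle] by blast
  have edges: "successively (edge M) q" if "successively (edge S) q" "set q \<subseteq> X" for q
    using that by (induction q) (auto simp: successively_Cons subset_iff intro!: F(4)[OF S(2)])
  have "successively (edge M) (y # p)" if "p \<in> Poly_Mapping.keys s" for p
    using edges[of "y # p"] s that by (force simp: X_def)
  moreover have "walk M (y # p)" "length p = Suc n" if "p \<in> Poly_Mapping.keys u" for p
    using tail_chainsD[OF u that] S(1) by (auto simp: walk_def modular_def)
  ultimately show thesis using that eq s(1) by blast
qed

section \<open>Cycles in a median space\<close>

definition boundary :: "('a list \<Rightarrow>\<^sub>0 int) \<Rightarrow> ('a list \<Rightarrow>\<^sub>0 int)" where
  "boundary = frag_extend (\<lambda>p. if p = [] then 0 else - prepend (hd p) (tail_boundary_path (hd p) (tl p)))"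

lemma boundary_diff: "boundary (a - b) = boundary a - boundary b"
  by (simp add: boundary_def frag_extend_diff)

lemma boundary_minus: "boundary (- a) = - boundary a"
  by (simp add: boundary_def frag_extend_minus)

lemma boundary_sum: "finite I \<Longrightarrow> boundary (\<Sum>i\<in>I. f i) = (\<Sum>i\<in>I. boundary (f i))"
  by (simp add: boundary_def frag_extend_sum)

lemma boundary_prepend: "boundary (prepend y c) = - prepend y (tail_boundary y c)"
  by (rule linear_eqI[where c = c]) (auto simp: prepend_diff boundary_diff tail_boundary_diff, simp add: boundary_def)

lemma boundary_boundary: "boundary (boundary c) = 0"
proof (rule linear_eqI[where c = c])
  fix p show "boundary (boundary (frag_of p)) = 0"
  proof (cases p)
    case (Cons y r)
    then have "boundary (frag_of p) = - prepend y (tail_boundary_path y r)" by (simp add: boundary_def)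
    then show ?thesis by (simp add: boundary_minus boundary_prepend tail_boundary_path_cycle)
  qed (simp add: boundary_def)
qed (auto simp: boundary_diff)

lemma tails_diff: "tails y (a - b) = tails y a - tails y b"
  by (simp add: tails_def frag_extend_diff)

lemma tails_minus: "tails y (- a) = - tails y a"
  by (simp add: tails_def frag_extend_minus)

lemma tails_prepend_other: "x \<noteq> y \<Longrightarrow> tails y (prepend x c) = 0"
  by (rule poly_mapping_eqI) (simp add: lookup_tails lookup_prepend_Cons)

lemma tails_boundary: "tails y (boundary c) = - tail_boundary y (tails y c)"
proof (rule linear_eqI[where c = c])
  fix p show "tails y (boundary (frag_of p)) = - tail_boundary y (tails y (frag_of p))"
  proof (cases p)
    case (Cons x r)
    then have "boundary (frag_of p) = - prepend x (tail_boundary_path x r)" "tails y (frag_of p) = (if x = y then frag_of r else 0)"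
      by (simp_all add: boundary_def tails_def)
    then show ?thesis by (cases "x = y") (simp_all add: tails_minus tails_prepend_other)
  qed (simp add: boundary_def tails_def)
qed (auto simp: boundary_diff tails_diff tail_boundary_diff)

lemma sum_prepend_tails:
  assumes "finite Y" "\<And>p. p \<in> Poly_Mapping.keys c \<Longrightarrow> p \<noteq> [] \<and> hd p \<in> Y"
  shows "c = (\<Sum>y\<in>Y. prepend y (tails y c))"
proof (rule poly_mapping_eqI)
  fix p
  have "poly_mapping.lookup (\<Sum>y\<in>Y. prepend y (tails y c)) p = (\<Sum>y\<in>Y. poly_mapping.lookup (prepend y (tails y c)) p)"
    by (rule lookup_sum)
  also have "\<dots> = (\<Sum>y\<in>Y. if p \<noteq> [] \<and> hd p = y then poly_mapping.lookup c p else 0)"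
    by (simp add: prepend_tails lookup_part)
  also have "\<dots> = poly_mapping.lookup c p"
    using assms by (cases "p \<in> Poly_Mapping.keys c") (auto simp: in_keys_iff sum.delta' intro!: sum.neutral)
  finally show "poly_mapping.lookup c p = poly_mapping.lookup (\<Sum>y\<in>Y. prepend y (tails y c)) p" by simp
qed

lemma median_cycle:
  assumes med: median and cycle: "boundary c = 0"
    and c: "\<forall>p\<in>Poly_Mapping.keys c. length p = Suc n \<and> walk M p"
  obtains s u where "c = s + boundary u" "\<forall>p\<in>Poly_Mapping.keys s. successively (edge M) p"
    "Poly_Mapping.keys s \<subseteq> Poly_Mapping.keys c"
    "\<forall>p\<in>Poly_Mapping.keys u. length p = Suc (Suc n) \<and> walk M p"
proof (cases "n = 0")
  case True
  have "successively (edge M) p" if "p \<in> Poly_Mapping.keys c" for p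
    using c that True by (cases p) auto
  then show thesis using that[of c 0] by (simp add: boundary_def)
next
  case False
  define Y where "Y = hd ` Poly_Mapping.keys c"
  have "\<exists>s u. tails y c = s + tail_boundary y u \<and> Poly_Mapping.keys s \<subseteq> Poly_Mapping.keys (tails y c) \<and>
      (\<forall>p\<in>Poly_Mapping.keys s. successively (edge M) (y # p)) \<and>
      (\<forall>p\<in>Poly_Mapping.keys u. length p = Suc n \<and> walk M (y # p))" if y: "y \<in> Y" for y
  proof -
    have "y \<in> M"
    proof -
      obtain p where p: "p \<in> Poly_Mapping.keys c" "y = hd p" using y unfolding Y_def by blast
      then have "walk M p" "p \<noteq> []" using c by auto
      then show ?thesis using p(2) by (auto simp: walk_def)
    qed
    moreover have "tail_boundary y (tails y c) = 0" using tails_boundary[of y c] cycle by (simp add: tails_def)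
    moreover have "length p = n \<and> walk M (y # p) \<and> p \<noteq> []" if "p \<in> Poly_Mapping.keys (tails y c)" for p
    proof -
      have "y # p \<in> Poly_Mapping.keys c" using that by (simp add: keys_tails)
      then have "length (y # p) = Suc n" "walk M (y # p)" using c by blast+
      then show ?thesis using False by auto
    qed
    ultimately obtain s u where "tails y c = s + tail_boundary y u" "Poly_Mapping.keys s \<subseteq> Poly_Mapping.keys (tails y c)"
      "\<forall>p\<in>Poly_Mapping.keys s. successively (edge M) (y # p)"
      "\<forall>p\<in>Poly_Mapping.keys u. length p = Suc n \<and> walk M (y # p)"
      using median_tail_cycle[OF med, of y "tails y c" n] by blast
    then show ?thesis by (intro exI conjI)
  qed
  then obtain s u where su: "\<And>y. y \<in> Y \<Longrightarrow> tails y c = s y + tail_boundary y (u y)"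
      "\<And>y. y \<in> Y \<Longrightarrow> Poly_Mapping.keys (s y) \<subseteq> Poly_Mapping.keys (tails y c)"
      "\<And>y p. y \<in> Y \<Longrightarrow> p \<in> Poly_Mapping.keys (s y) \<Longrightarrow> successively (edge M) (y # p)"
      "\<And>y p. y \<in> Y \<Longrightarrow> p \<in> Poly_Mapping.keys (u y) \<Longrightarrow> length p = Suc n \<and> walk M (y # p)"
    by metis
  let ?s = "\<Sum>y\<in>Y. prepend y (s y)" and ?u = "\<Sum>y\<in>Y. - prepend y (u y)"
  have "finite Y" by (simp add: Y_def)
  have "c = (\<Sum>y\<in>Y. prepend y (tails y c))"
    by (rule sum_prepend_tails) (use c in \<open>auto simp: Y_def\<close>)
  also have "\<dots> = (\<Sum>y\<in>Y. prepend y (s y) + boundary (- prepend y (u y)))"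
    by (rule sum.cong) (simp_all add: su(1) prepend_add boundary_minus boundary_prepend)
  finally have "c = ?s + boundary ?u"
    using \<open>finite Y\<close> by (simp add: sum.distrib boundary_sum)
  moreover have s_keys: "\<exists>y\<in>Y. \<exists>q\<in>Poly_Mapping.keys (s y). p = y # q" if "p \<in> Poly_Mapping.keys ?s" for p
    using subsetD[OF keys_sum that] by (auto simp: keys_prepend)
  moreover have u_keys: "\<exists>y\<in>Y. \<exists>q\<in>Poly_Mapping.keys (u y). p = y # q" if "p \<in> Poly_Mapping.keys ?u" for p
    using subsetD[OF keys_sum that] by (auto simp: keys_prepend)
  ultimately show thesis
  proof (intro that)
    show "\<forall>p\<in>Poly_Mapping.keys ?s. successively (edge M) p" using s_keys su(3) by blast
    show "Poly_Mapping.keys ?s \<subseteq> Poly_Mapping.keys c" using s_keys su(2) by (fastforce simp: keys_tails)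
    show "\<forall>p\<in>Poly_Mapping.keys ?u. length p = Suc (Suc n) \<and> walk M p" using u_keys su(4) by fastforce
  qed
qed

end

lemma prepend_cmul: "prepend x (frag_cmul k c) = frag_cmul k (prepend x c)"
  by (simp add: prepend_def frag_extend_cmul)

lemma prepend_sum: "finite I \<Longrightarrow> prepend x (\<Sum>i\<in>I. f i) = (\<Sum>i\<in>I. prepend x (f i))"
  by (simp add: prepend_def frag_extend_sum)

section \<open>The magnitude complex\<close>

context Metric_space
begin

definition between :: "'a \<Rightarrow> 'a \<Rightarrow> 'a \<Rightarrow> bool" where
  "between x y z \<longleftrightarrow> x \<in> M \<and> z \<in> M \<and> y \<in> interval x z"

sublocale betweenness M between
proof
  fix x y z w
  show "between x y z \<Longrightarrow> x \<in> M \<and> y \<in> M \<and> z \<in> M" by (simp add: between_def interval_def)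
  show "x \<in> M \<Longrightarrow> y \<in> M \<Longrightarrow> between x x y" by (simp add: between_def interval_def)
  show "between x y z \<Longrightarrow> between z y x" by (auto simp: between_def interval_def commute)
  show "between x y x \<Longrightarrow> y = x" by (auto simp: between_def interval_def commute)
  show "between x y z \<and> between x z w \<longleftrightarrow> between y z w \<and> between x y w"
    using triangle[of x y z] triangle[of y z w] triangle[of x y w] triangle[of x z w]
    by (auto simp: between_def interval_def)
qed

lemma median_space_median: "median_space \<Longrightarrow> median"
  unfolding median_space_def median_def
proof (intro ballI)
  fix x y z assume "\<forall>x\<in>M. \<forall>y\<in>M. \<forall>z\<in>M. \<exists>m. interval x y \<inter> interval y z \<inter> interval x z = {m}"
    and M: "x \<in> M" "y \<in> M" "z \<in> M"
  then obtain m where m: "interval x y \<inter> interval y z \<inter> interval x z = {m}" by blast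
  show "\<exists>!m. between x m y \<and> between y m z \<and> between x m z"
    using m M unfolding between_def by (intro ex1I[of _ m]) blast+
qed

text \<open>
  The indexed conditions on consecutive points become structural ones, which suit induction on lists.
\<close>

lemma paths_walk: "p \<in> paths k \<longleftrightarrow> length p = Suc k \<and> walk M p"
  by (auto simp: paths_def walk_def successively_conv_nth)

lemma saturated_paths_edges: "p \<in> saturated_paths k \<longleftrightarrow> length p = Suc k \<and> walk M p \<and> successively (edge M) p"
proof (cases "length p = Suc k \<and> walk M p")
  case True
  have "open_interval (p ! i) (p ! Suc i) = {} \<longleftrightarrow> edge M (p ! i) (p ! Suc i)" if "i < k" for i
  proof -
    have "p ! i \<in> M" "p ! Suc i \<in> M" using True that by (auto simp: walk_def)
    moreover have "p ! i \<noteq> p ! Suc i" using True that by (auto simp: walk_def successively_conv_nth)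
    ultimately show ?thesis
      by (auto simp: open_interval_def edge_def between_def) (auto simp: interval_def)
  qed
  then show ?thesis using True by (auto simp: saturated_paths_def paths_walk successively_conv_nth)
qed (auto simp: saturated_paths_def paths_walk)

lemma face_frag_of:
  "face i (frag_of p) = (if p ! i \<in> interval (p ! (i - 1)) (p ! Suc i)
     then frag_of (take i p @ drop (Suc i) p) else 0)"
  by (simp add: face_def)

lemma face_Suc_Cons: "0 < i \<Longrightarrow> face (Suc i) (frag_of (y # p)) = prepend y (face i (frag_of p))"
  by (cases i) (auto simp: face_frag_of)

text \<open>
  The recursion for the boundary splits off the face that deletes the second point; the other faces
  are those of the path without its first point, with an index shift that accounts for the sign.
\<close>

lemma magnitude_boundary_path:
  "set (y # r) \<subseteq> M \<Longrightarrow> magnitude_boundary (length r) (frag_of (y # r)) = - prepend y (tail_boundary_path y r)"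
proof (induction r arbitrary: y)
  case Nil
  then show ?case by (simp add: magnitude_boundary_def)
next
  case (Cons x t)
  show ?case
  proof (cases "t = []")
    case True then show ?thesis by (simp add: magnitude_boundary_def)
  next
    case False
    then have "0 < length t" by simp
    let ?f = "\<lambda>i. frag_cmul ((-1) ^ i) (face i (frag_of (y # x # t)))"
    have first: "?f 1 = - (if between y x (hd t) then frag_of (y # t) else 0)"
      using False Cons.prems by (cases t) (auto simp: face_frag_of between_def)
    have "(\<Sum>i = Suc 1..<Suc (length t). ?f i) = (\<Sum>i = 1..<length t. ?f (Suc i))"
      by (rule sum.shift_bounds_Suc_ivl)
    also have "\<dots> = (\<Sum>i = 1..<length t. - prepend y (frag_cmul ((-1) ^ i) (face i (frag_of (x # t)))))"
      by (rule sum.cong) (simp_all add: face_Suc_Cons prepend_cmul)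
    also have "\<dots> = - prepend y (magnitude_boundary (length t) (frag_of (x # t)))"
      by (simp add: magnitude_boundary_def prepend_sum sum_negf)
    also have "\<dots> = prepend y (prepend x (tail_boundary_path x t))"
      using Cons by (simp add: prepend_def frag_extend_minus)
    finally have rest: "(\<Sum>i = Suc 1..<Suc (length t). ?f i) = prepend y (prepend x (tail_boundary_path x t))" .
    have "magnitude_boundary (length (x # t)) (frag_of (y # x # t)) = (\<Sum>i = 1..<Suc (length t). ?f i)"
      by (simp add: magnitude_boundary_def)
    also have "\<dots> = ?f 1 + (\<Sum>i = Suc 1..<Suc (length t). ?f i)"
      using \<open>0 < length t\<close> by (intro sum.atLeast_Suc_lessThan) simp
    also have "\<dots> = - prepend y (tail_boundary_path y (x # t))"
      unfolding first rest using False by (simp add: prepend_diff)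
    finally show ?thesis .
  qed
qed

lemma magnitude_boundary_diff:
  "magnitude_boundary k (a - b) = magnitude_boundary k a - magnitude_boundary k b"
proof -
  have "frag_cmul c (face i (a - b)) = frag_cmul c (face i a) - frag_cmul c (face i b)" for c i
    by (rule poly_mapping_eqI) (simp add: face_def frag_extend_diff lookup_minus algebra_simps)
  then show ?thesis by (simp add: magnitude_boundary_def sum_subtractf)
qed

lemma magnitude_boundary_eq_boundary:
  assumes "Poly_Mapping.keys c \<subseteq> paths k"
  shows "magnitude_boundary k c = boundary c"
proof (rule linear_eqI[where c = c])
  fix p assume "p \<in> Poly_Mapping.keys c"
  then have p: "length p = Suc k" "set p \<subseteq> M" using assms by (auto simp: paths_def)
  then obtain y r where "p = y # r" "length r = k" by (cases p) auto
  then show "magnitude_boundary k (frag_of p) = boundary (frag_of p)"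
    using magnitude_boundary_path[of y r] p(2) by (simp add: boundary_def)
qed (auto simp: magnitude_boundary_diff boundary_diff)

lemma keys_boundary:
  assumes "Poly_Mapping.keys c \<subseteq> paths (Suc k)"
  shows "Poly_Mapping.keys (boundary c) \<subseteq> paths k"
proof
  fix q assume "q \<in> Poly_Mapping.keys (boundary c)"
  then have "q \<in> (\<Union>p\<in>Poly_Mapping.keys c. Poly_Mapping.keys (if p = [] then 0 else - prepend (hd p) (tail_boundary_path (hd p) (tl p))))"
    unfolding boundary_def by (rule subsetD[OF keys_frag_extend])
  then obtain p where p: "p \<in> Poly_Mapping.keys c"
    "q \<in> Poly_Mapping.keys (if p = [] then 0 else - prepend (hd p) (tail_boundary_path (hd p) (tl p)))" by blast
  have "p \<in> paths (Suc k)" using assms p(1) by blast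
  then have walk: "length p = Suc (Suc k)" "walk M p" by (simp_all add: paths_walk)
  then obtain y r where y: "p = y # r" by (cases p) auto
  then obtain q' where "q = y # q'" "q' \<in> Poly_Mapping.keys (tail_boundary_path y r)"
    using p(2) by (auto simp: keys_prepend)
  then have f: "is_face p q" using keys_tail_boundary_path_face y by simp
  show "q \<in> paths k"
    using face_walk[OF f walk(2)] face_props[OF f] walk(1) by (simp add: paths_walk)
qed

lemma mem_magnitude_cycles:
  "c \<in> magnitude_cycles k \<longleftrightarrow> Poly_Mapping.keys c \<subseteq> paths k \<and> boundary c = 0"
  by (auto simp: magnitude_cycles_def magnitude_chains_def magnitude_boundary_eq_boundary)

lemma magnitude_boundaries_eq:
  "magnitude_boundaries k = boundary ` {c. Poly_Mapping.keys c \<subseteq> paths (Suc k)}"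
  unfolding magnitude_boundaries_def magnitude_chains_def
  by (rule image_cong) (auto simp: magnitude_boundary_eq_boundary)

lemma boundaries_cycles: "magnitude_boundaries k \<subseteq> magnitude_cycles k"
proof
  fix b assume "b \<in> magnitude_boundaries k"
  then obtain c where "b = boundary c" "Poly_Mapping.keys c \<subseteq> paths (Suc k)"
    unfolding magnitude_boundaries_eq by blast
  then show "b \<in> magnitude_cycles k" by (simp add: mem_magnitude_cycles keys_boundary boundary_boundary)
qed

lemma boundary_add: "boundary (a + b) = boundary a + boundary b"
  by (simp add: boundary_def frag_extend_add)

lemma boundary_0: "boundary 0 = 0"
  by (simp add: boundary_def)

lemma subgroup_magnitude_cycles: "subgroup (magnitude_cycles k) (magnitude_chains k)"
proof -
  interpret group "magnitude_chains k" by (simp add: magnitude_chains_def)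
  show ?thesis
  proof (rule subgroupI)
    show "magnitude_cycles k \<subseteq> carrier (magnitude_chains k)" by (auto simp: magnitude_cycles_def)
    show "magnitude_cycles k \<noteq> {}" using mem_magnitude_cycles[of 0] boundary_0 by auto
    show "inv\<^bsub>magnitude_chains k\<^esub> a \<in> magnitude_cycles k" if "a \<in> magnitude_cycles k" for a
      using that by (simp add: magnitude_chains_def mem_magnitude_cycles boundary_minus)
    show "a \<otimes>\<^bsub>magnitude_chains k\<^esub> b \<in> magnitude_cycles k"
      if "a \<in> magnitude_cycles k" "b \<in> magnitude_cycles k" for a b
      using that keys_add[of a b] by (auto simp: magnitude_chains_def mem_magnitude_cycles boundary_add)
  qed
qed

lemma carrier_magnitude_cycle_group [simp]: "carrier (magnitude_cycle_group k) = magnitude_cycles k"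
  unfolding magnitude_cycle_group_def
  by (rule subgroup.carrier_subgroup_generated_subgroup[OF subgroup_magnitude_cycles])

lemma mult_magnitude_cycle_group [simp]: "x \<otimes>\<^bsub>magnitude_cycle_group k\<^esub> y = x + y"
  by (simp add: magnitude_cycle_group_def magnitude_chains_def)

lemma comm_group_magnitude_cycle_group: "comm_group (magnitude_cycle_group k)"
proof -
  interpret comm_group "magnitude_chains k" by (simp add: magnitude_chains_def abelian_free_Abelian_group)
  show ?thesis unfolding magnitude_cycle_group_def by (rule abelian_subgroup_generated[OF comm_group_axioms])
qed

lemma inv_magnitude_cycle_group:
  assumes "x \<in> magnitude_cycles k"
  shows "inv\<^bsub>magnitude_cycle_group k\<^esub> x = - x"
proof -
  interpret comm_group "magnitude_cycle_group k" by (rule comm_group_magnitude_cycle_group)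
  have "- x \<in> magnitude_cycles k" "0 \<in> magnitude_cycles k"
    using assms by (simp_all add: mem_magnitude_cycles boundary_minus boundary_0)
  moreover have "\<one>\<^bsub>magnitude_cycle_group k\<^esub> = 0"
    by (simp add: magnitude_cycle_group_def magnitude_chains_def)
  ultimately show ?thesis using assms by (intro inv_equality) auto
qed

lemma subgroup_magnitude_boundaries: "subgroup (magnitude_boundaries k) (magnitude_cycle_group k)"
proof -
  interpret comm_group "magnitude_cycle_group k" by (rule comm_group_magnitude_cycle_group)
  show ?thesis
  proof (rule subgroupI)
    show "magnitude_boundaries k \<subseteq> carrier (magnitude_cycle_group k)" using boundaries_cycles by simp
    show "magnitude_boundaries k \<noteq> {}" by (auto simp: magnitude_boundaries_eq intro: exI[of _ 0])
  next
    fix a assume a: "a \<in> magnitude_boundaries k"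
    then obtain c where "a = boundary c" "Poly_Mapping.keys c \<subseteq> paths (Suc k)" by (auto simp: magnitude_boundaries_eq)
    then have "- a \<in> magnitude_boundaries k"
      unfolding magnitude_boundaries_eq by (intro image_eqI[of _ _ "- c"]) (auto simp: boundary_minus)
    then show "inv\<^bsub>magnitude_cycle_group k\<^esub> a \<in> magnitude_boundaries k"
      using inv_magnitude_cycle_group a boundaries_cycles by fastforce
  next
    fix a b assume "a \<in> magnitude_boundaries k" "b \<in> magnitude_boundaries k"
    then obtain c c' where "a = boundary c" "Poly_Mapping.keys c \<subseteq> paths (Suc k)"
      "b = boundary c'" "Poly_Mapping.keys c' \<subseteq> paths (Suc k)" by (auto simp: magnitude_boundaries_eq)
    then show "a \<otimes>\<^bsub>magnitude_cycle_group k\<^esub> b \<in> magnitude_boundaries k"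
      using keys_add[of c c'] unfolding magnitude_boundaries_eq
      by (intro image_eqI[of _ _ "c + c'"]) (auto simp: boundary_add)
  qed
qed

text \<open>
  That \<open>magnitude_homology k\<close> is a group is needed for its subset generated by saturated classes to
  stay inside its carrier.
\<close>

lemma normal_magnitude_boundaries: "normal (magnitude_boundaries k) (magnitude_cycle_group k)"
  using comm_group.normal_iff_subgroup[OF comm_group_magnitude_cycle_group] subgroup_magnitude_boundaries
  by blast

lemma carrier_magnitude_homology:
  "carrier (magnitude_homology k) = homology_class k ` magnitude_cycles k"
  by (auto simp: magnitude_homology_def FactGroup_def RCOSETS_def homology_class_def)

lemma homology_class_cong:
  assumes "s \<in> magnitude_cycles k" "b \<in> magnitude_boundaries k"
  shows "homology_class k (s + b) = homology_class k s"
proof -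
  interpret comm_group "magnitude_cycle_group k" by (rule comm_group_magnitude_cycle_group)
  have "s + b \<in> homology_class k s"
    unfolding homology_class_def r_coset_def using assms by (auto simp: add.commute)
  then show ?thesis
    using repr_independence[OF _ _ subgroup_magnitude_boundaries] assms(1) unfolding homology_class_def by fastforce
qed

text \<open>
  It suffices that each homology class contains a saturated cycle: then every element is itself one
  of the generators.
\<close>

lemma diagonalI:
  assumes "\<And>k z. z \<in> magnitude_cycles k \<Longrightarrow>
    \<exists>s b. z = s + b \<and> b \<in> magnitude_boundaries k \<and> s \<in> magnitude_cycles k \<and> Poly_Mapping.keys s \<subseteq> saturated_paths k"
  shows diagonal
  unfolding diagonal_def
proof (intro allI subset_antisym subsetI)
  fix k x assume "x \<in> carrier (magnitude_homology k)"
  then obtain z where z: "z \<in> magnitude_cycles k" "x = homology_class k z"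
    by (auto simp: carrier_magnitude_homology)
  then obtain s b where "z = s + b" "b \<in> magnitude_boundaries k" "s \<in> magnitude_cycles k"
    "Poly_Mapping.keys s \<subseteq> saturated_paths k" using assms by blast
  then show "x \<in> generate (magnitude_homology k) {homology_class k z | z.
      z \<in> magnitude_cycles k \<and> Poly_Mapping.keys z \<subseteq> saturated_paths k}"
    using z(2) homology_class_cong by (intro generate.incl) auto
next
  fix k x assume *: "x \<in> generate (magnitude_homology k) {homology_class k z | z.
      z \<in> magnitude_cycles k \<and> Poly_Mapping.keys z \<subseteq> saturated_paths k}"
  interpret group "magnitude_homology k"
    unfolding magnitude_homology_def by (rule normal.factorgroup_is_group[OF normal_magnitude_boundaries])
  show "x \<in> carrier (magnitude_homology k)"
    by (rule generate_in_carrier[OF _ *]) (auto simp: carrier_magnitude_homology)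
qed

lemma median_space_diagonal:
  assumes median_space
  shows diagonal
proof (rule diagonalI)
  fix k z assume "z \<in> magnitude_cycles k"
  then have z: "Poly_Mapping.keys z \<subseteq> paths k" "boundary z = 0" by (simp_all add: mem_magnitude_cycles)
  then have "\<forall>p\<in>Poly_Mapping.keys z. length p = Suc k \<and> walk M p" by (auto simp: paths_walk)
  then obtain s u where eq: "z = s + boundary u"
    and edges: "\<forall>p\<in>Poly_Mapping.keys s. successively (edge M) p"
    and s: "Poly_Mapping.keys s \<subseteq> Poly_Mapping.keys z"
    and u: "\<forall>p\<in>Poly_Mapping.keys u. length p = Suc (Suc k) \<and> walk M p"
    using median_cycle[OF median_space_median[OF assms] z(2)] by blast
  have "boundary s = 0" using z(2) by (simp add: eq boundary_add boundary_boundary)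
  moreover have "boundary u \<in> magnitude_boundaries k" using u by (auto simp: magnitude_boundaries_eq paths_walk)
  moreover have "Poly_Mapping.keys s \<subseteq> saturated_paths k"
    using edges s z(1) by (auto simp: saturated_paths_edges paths_walk)
  ultimately show "\<exists>s b. z = s + b \<and> b \<in> magnitude_boundaries k \<and> s \<in> magnitude_cycles k \<and>
      Poly_Mapping.keys s \<subseteq> saturated_paths k"
    using eq s z(1) mem_magnitude_cycles[of s k] by (intro exI[of _ s] exI[of _ "boundary u"]) auto
qed

end

theorem proposition5p3:
  fixes M :: "'a set" and d :: "'a \<Rightarrow> 'a \<Rightarrow> real"
  assumes "Metric_space M d"
    and "Metric_space.median_space M d"
  shows "Metric_space.diagonal M d"
  using assms by (rule Metric_space.median_space_diagonal)

end
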